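(* Let $\alpha=(\alpha_1,\dots,\alpha_n)$ be a nonzero vector, $\xi(x)=\sum_{i=1}^n\alpha_ix_i$ on $\mathbb{R}^n$, and let $\varphi>0$, $f>0$, $h$, $u$ be smooth functions on $\mathbb{R}^n$ of the form $\varphi\circ\xi$, $f\circ\xi$, $h\circ\xi$, $u\circ\xi$, with $u$ non-constant. Let $(F^m,g_F)$ be a semi-Riemannian manifold, $\lambda\in\mathbb{R}$, $\theta\ge0$. Consider $\mathbb{R}^n\times F^m$ with the warped product metric $g=\varphi^{-2}g_0+f^2g_F$ (base $(\mathbb{R}^n,\varphi^{-2}g_0)$, fiber $(F,g_F)$, warping function $f$), and regard $h$ and $u$ as functions on $\mathbb{R}^n\times F$ through the projection $\pi$ to $\mathbb{R}^n$. Then $(\mathbb{R}^n\times_fF^m,g,h,u,\lambda)$ is a GRHS (with constant $\theta$) if and only if there is a constant $\mu$ such that $Ric_{g_F}=\mu g_F$ and the following equations hold: $$(n-2)\frac{\varphi''}{\varphi}-m\frac{f''}{f}-2m\frac{\varphi'}{\varphi}\frac{f'}{f}+h''+2\frac{\varphi'}{\varphi}h'-\theta(u')^2=0,$$ $$\left[\frac{\varphi''}{\varphi}-(n-1)\left(\frac{\varphi'}{\varphi}\right)^2+m\frac{\varphi'}{\varphi}\frac{f'}{f}-\frac{\varphi'}{\varphi}h'\right]\|\alpha\|^2=\frac{\lambda}{\varphi^2},$$ $$\left[\frac{f''}{f}-(n-2)\frac{\varphi'}{\varphi}\frac{f'}{f}+(m-1)\left(\frac{f'}{f}\right)^2-\frac{f'}{f}h'\right]\|\alpha\|^2=\frac{\mu}{f^2\varphi^2}-\frac{\lambda}{\varphi^2},$$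 $$\left[u''-(n-2)\frac{\varphi'}{\varphi}u'+mu'\frac{f'}{f}-u'h'\right]\|\alpha\|^2=0.$$
   Context: $g_0$ is the semi-Euclidean metric on $\mathbb{R}^n$ with $(g_0)_{ij}=\epsilon_i\delta_{ij}$, $\epsilon_i=\pm1$, and $\|\alpha\|^2=\sum_i\epsilon_i\alpha_i^2$ (which may be zero or negative). Functions of $\xi$ are identified with functions of one real variable, and primes denote derivatives with respect to $\xi$. For a semi-Riemannian manifold $(M,g)$, smooth $u,h:M\to\mathbb{R}$ and $\lambda\in\mathbb{R}$, $(M,g,h,u,\lambda)$ is a gradient Ricci-harmonic soliton (GRHS) with constant $\theta\ge0$ if $$Ric_g+Hess\,h-\theta\,\nabla u\otimes\nabla u=\lambda g,\qquad \Delta_gu-g(\nabla u,\nabla h)=0,$$ where $(\nabla u\otimes\nabla u)(X,Y)=X(u)Y(u)$ and $\Delta_g=\mathrm{tr}_gHess$; $u$ is called the harmonic map.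
   Formalization: The dimension n is assumed to be at least 2; for n = 1 the equivalence fails, e.g. φ = f = 1, ξ = x, θ = 0, λ = 1, h = x²/2, u' = exp(x²/2), F the unit sphere S²: a GRHS, but the second equation reads 0 = 1. *)

theory Defs
  imports "HOL-Analysis.Analysis"
begin

section \<open>Smooth maps between open subsets of Euclidean spaces\<close>

abbreviation dir_deriv :: "('e::real_normed_vector \<Rightarrow> 'b::real_normed_vector) \<Rightarrow> 'e \<Rightarrow> 'e \<Rightarrow> 'b"
  where "dir_deriv f v x \<equiv> frechet_derivative f (at x) v"

text \<open>Only meant for open sets and finite-dimensional domains.\<close>

primrec Ck_on :: "nat \<Rightarrow> ('e::real_normed_vector \<Rightarrow> 'b::real_normed_vector) \<Rightarrow> 'e set \<Rightarrow> bool"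
  where
    "Ck_on 0 f S \<longleftrightarrow> continuous_on S f"
  | "Ck_on (Suc k) f S \<longleftrightarrow>
       (\<forall>x\<in>S. f differentiable (at x)) \<and> (\<forall>v. Ck_on k (dir_deriv f v) S)"

definition smooth_on :: "('e::real_normed_vector \<Rightarrow> 'b::real_normed_vector) \<Rightarrow> 'e set \<Rightarrow> bool"
  where "smooth_on f S \<longleftrightarrow> (\<forall>k. Ck_on k f S)"

section \<open>Smooth manifolds and tangent vectors\<close>

text \<open>
  A chart is a pair of an open domain and a coordinate map into a Euclidean model space.
  A manifold is given by an atlas (not necessarily maximal); its points are the points covered
  by the chart domains, and it inherits the topology of the ambient type, which is Hausdorff and
  second countable. Manifolds are nonempty.
\<close>

type_synonym ('p, 'e) chart = "'p set \<times> ('p \<Rightarrow> 'e)"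

definition smooth_atlas ::
  "('p::{t2_space,second_countable_topology}, 'e::euclidean_space) chart set \<Rightarrow> bool"
  where "smooth_atlas A \<longleftrightarrow>
    (\<exists>(U, c)\<in>A. U \<noteq> {}) \<and>
    (\<forall>(U, c)\<in>A. open U \<and> open (c ` U) \<and> homeomorphism U (c ` U) c (inv_into U c)) \<and>
    (\<forall>(U, c)\<in>A. \<forall>(V, d)\<in>A. smooth_on (d \<circ> inv_into U c) (c ` (U \<inter> V)))"

definition smooth_fun :: "('p, 'e::euclidean_space) chart set \<Rightarrow> ('p \<Rightarrow> real) \<Rightarrow> bool"
  where "smooth_fun A f \<longleftrightarrow> (\<forall>(U, c)\<in>A. smooth_on (f \<circ> inv_into U c) (c ` U))"

text \<open>
  Tangent vectors are represented as derivations on functions. \<open>coord_vector (U, c) p v\<close> is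
  the tangent vector at \<open>p \<in> U\<close> with components \<open>v\<close> in the chart \<open>(U, c)\<close>; as \<open>v\<close> varies it runs
  through the tangent space at \<open>p\<close>. Functions that are not differentiable at \<open>p\<close> (a condition
  independent of the chart) are sent to 0, so that two charts describe the same derivation
  exactly when the components are related by the derivative of the coordinate change.
\<close>

type_synonym 'p tangent = "('p \<Rightarrow> real) \<Rightarrow> real"

definition coord_vector :: "('p, 'e::euclidean_space) chart \<Rightarrow> 'p \<Rightarrow> 'e \<Rightarrow> 'p tangent"
  where "coord_vector = (\<lambda>(U, c) p v f.
    if (f \<circ> inv_into U c) differentiable (at (c p)) then dir_deriv (f \<circ> inv_into U c) v (c p)
    else 0)"

definition push_forward :: "('p \<Rightarrow> 'q) \<Rightarrow> 'p tangent \<Rightarrow> 'q tangent"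
  where "push_forward F X = (\<lambda>f. X (f \<circ> F))"

definition euclidean_atlas :: "('e, 'e::euclidean_space) chart set"
  where "euclidean_atlas = {(UNIV, id)}"

definition prod_atlas ::
  "('p, 'd) chart set \<Rightarrow> ('q, 'e) chart set \<Rightarrow> ('p \<times> 'q, 'd \<times> 'e) chart set"
  where "prod_atlas A B = {(U \<times> V, map_prod c d) | U c V d. (U, c) \<in> A \<and> (V, d) \<in> B}"

section \<open>Semi-Riemannian manifolds\<close>

text \<open>Only the values of a metric on tangent vectors at the given point matter.\<close>

type_synonym 'p metric = "'p \<Rightarrow> 'p tangent \<Rightarrow> 'p tangent \<Rightarrow> real"

definition components ::
  "'p metric \<Rightarrow> ('p, 'e::euclidean_space) chart \<Rightarrow> 'e \<Rightarrow> 'e \<Rightarrow> 'e \<Rightarrow> real"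
  where "components g = (\<lambda>(U, c) x v w.
    let p = inv_into U c x in g p (coord_vector (U, c) p v) (coord_vector (U, c) p w))"

text \<open>The index is the number of negative signs in an orthonormal basis.\<close>

definition has_index :: "('e::euclidean_space \<Rightarrow> 'e \<Rightarrow> real) \<Rightarrow> nat \<Rightarrow> bool"
  where "has_index b q \<longleftrightarrow> (\<exists>(e :: 'e \<Rightarrow> 'e) (s :: 'e \<Rightarrow> real).
    (\<forall>i\<in>Basis. s i = 1 \<or> s i = - 1) \<and>
    (\<forall>i\<in>Basis. \<forall>j\<in>Basis. b (e i) (e j) = (if i = j then s i else 0)) \<and>
    card {i \<in> Basis. s i = - 1} = q)"

definition semi_riemannian ::
  "('p::{t2_space,second_countable_topology}, 'e::euclidean_space) chart set \<Rightarrow> 'p metric \<Rightarrow> bool"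
  where "semi_riemannian A g \<longleftrightarrow>
    smooth_atlas A \<and>
    (\<forall>(U, c)\<in>A.
       (\<forall>v w. smooth_on (\<lambda>x. components g (U, c) x v w) (c ` U)) \<and>
       (\<forall>x\<in>c ` U.
          bilinear (components g (U, c) x) \<and>
          (\<forall>v w. components g (U, c) x v w = components g (U, c) x w v) \<and>
          (\<forall>v. (\<forall>w. components g (U, c) x v w = 0) \<longrightarrow> v = 0))) \<and>
    (\<exists>q. \<forall>(U, c)\<in>A. \<forall>x\<in>c ` U. has_index (components g (U, c) x) q)"

text \<open>\<open>dx\<^sub>i(X) = X(x\<^sub>i)\<close>, so this is \<open>\<Sum>\<^sub>i \<epsilon>\<^sub>i dx\<^sub>i \<otimes> dx\<^sub>i\<close>.\<close>

definition semi_euclidean :: "('n::finite \<Rightarrow> real) \<Rightarrow> (real ^ 'n) metric"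
  where "semi_euclidean \<epsilon> x X Y = (\<Sum>i\<in>UNIV. \<epsilon> i * X (\<lambda>y. y $ i) * Y (\<lambda>y. y $ i))"

definition scale_metric :: "('p \<Rightarrow> real) \<Rightarrow> 'p metric \<Rightarrow> 'p metric"
  where "scale_metric r g p X Y = r p * g p X Y"

text \<open>\<open>\<pi>\<^sup>* g\<^sub>B + (f \<circ> \<pi>)\<^sup>2 \<sigma>\<^sup>* g\<^sub>F\<close> with the two projections \<open>\<pi> = fst\<close> and \<open>\<sigma> = snd\<close>.\<close>

definition warped_product :: "'b metric \<Rightarrow> ('b \<Rightarrow> real) \<Rightarrow> 'f metric \<Rightarrow> ('b \<times> 'f) metric"
  where "warped_product gB f gF p X Y =
    gB (fst p) (push_forward fst X) (push_forward fst Y) +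
    (f (fst p))\<^sup>2 * gF (snd p) (push_forward snd X) (push_forward snd Y)"

section \<open>Curvature and Hessian in coordinates\<close>

text \<open>
  In this section \<open>g x v w\<close> denotes the components of a metric in a chart.
  \<open>sharp b \<omega>\<close> is the vector dual to the covector \<open>\<omega>\<close> with respect to the nondegenerate form \<open>b\<close>.
\<close>

definition sharp :: "('e \<Rightarrow> 'e \<Rightarrow> real) \<Rightarrow> ('e \<Rightarrow> real) \<Rightarrow> 'e"
  where "sharp b \<omega> = (THE v. \<forall>w. b v w = \<omega> w)"

text \<open>The Levi-Civita connection \<open>\<nabla>\<^sub>v w\<close> for constant coordinate vector fields \<open>v\<close>, \<open>w\<close> (Koszul).\<close>

definition christoffel :: "('e::euclidean_space \<Rightarrow> 'e \<Rightarrow> 'e \<Rightarrow> real) \<Rightarrow> 'e \<Rightarrow> 'e \<Rightarrow> 'e \<Rightarrow> 'e"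
  where "christoffel g x v w = sharp (g x) (\<lambda>z.
    (dir_deriv (\<lambda>y. g y w z) v x + dir_deriv (\<lambda>y. g y v z) w x - dir_deriv (\<lambda>y. g y v w) z x) / 2)"

text \<open>\<open>R(u,v)w = \<nabla>\<^sub>u \<nabla>\<^sub>v w - \<nabla>\<^sub>v \<nabla>\<^sub>u w\<close> for constant coordinate vector fields, and
  \<open>Ric(v,w)\<close> is the trace of \<open>u \<mapsto> R(u,v)w\<close>.\<close>

definition riemann ::
  "('e::euclidean_space \<Rightarrow> 'e \<Rightarrow> 'e \<Rightarrow> real) \<Rightarrow> 'e \<Rightarrow> 'e \<Rightarrow> 'e \<Rightarrow> 'e \<Rightarrow> 'e"
  where "riemann g x u v w =
    dir_deriv (\<lambda>y. christoffel g y v w) u x - dir_deriv (\<lambda>y. christoffel g y u w) v x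
    + christoffel g x u (christoffel g x v w) - christoffel g x v (christoffel g x u w)"

definition ricci :: "('e::euclidean_space \<Rightarrow> 'e \<Rightarrow> 'e \<Rightarrow> real) \<Rightarrow> 'e \<Rightarrow> 'e \<Rightarrow> 'e \<Rightarrow> real"
  where "ricci g x v w = (\<Sum>b\<in>Basis. riemann g x b v w \<bullet> b)"

definition hess ::
  "('e::euclidean_space \<Rightarrow> 'e \<Rightarrow> 'e \<Rightarrow> real) \<Rightarrow> ('e \<Rightarrow> real) \<Rightarrow> 'e \<Rightarrow> 'e \<Rightarrow> 'e \<Rightarrow> real"
  where "hess g h x v w = dir_deriv (dir_deriv h w) v x - dir_deriv h (christoffel g x v w) x"

text \<open>Trace of a bilinear form with respect to the metric: \<open>g\<^sup>i\<^sup>j T\<^sub>i\<^sub>j\<close>.\<close>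

definition metric_trace :: "('e::euclidean_space \<Rightarrow> 'e \<Rightarrow> real) \<Rightarrow> ('e \<Rightarrow> 'e \<Rightarrow> real) \<Rightarrow> real"
  where "metric_trace b T = (\<Sum>e\<in>Basis. sharp b (T e) \<bullet> e)"

definition laplacian ::
  "('e::euclidean_space \<Rightarrow> 'e \<Rightarrow> 'e \<Rightarrow> real) \<Rightarrow> ('e \<Rightarrow> real) \<Rightarrow> 'e \<Rightarrow> real"
  where "laplacian g u x = metric_trace (g x) (hess g u x)"

definition grad :: "('e::euclidean_space \<Rightarrow> 'e \<Rightarrow> 'e \<Rightarrow> real) \<Rightarrow> ('e \<Rightarrow> real) \<Rightarrow> 'e \<Rightarrow> 'e"
  where "grad g u x = sharp (g x) (\<lambda>v. dir_deriv u v x)"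

section \<open>Gradient Ricci-harmonic solitons\<close>

text \<open>Tensor identities are stated for the components in every chart of the atlas.\<close>

definition ricci_eq_metric ::
  "('p, 'e::euclidean_space) chart set \<Rightarrow> 'p metric \<Rightarrow> real \<Rightarrow> bool"
  where "ricci_eq_metric A g \<mu> \<longleftrightarrow>
    (\<forall>(U, c)\<in>A. \<forall>x\<in>c ` U. \<forall>v w.
       ricci (components g (U, c)) x v w = \<mu> * components g (U, c) x v w)"

definition GRHS ::
  "('p::{t2_space,second_countable_topology}, 'e::euclidean_space) chart set \<Rightarrow> 'p metric \<Rightarrow>
   ('p \<Rightarrow> real) \<Rightarrow> ('p \<Rightarrow> real) \<Rightarrow> real \<Rightarrow> real \<Rightarrow> bool"
  where "GRHS A g h u lam \<theta> \<longleftrightarrow>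
    semi_riemannian A g \<and> smooth_fun A h \<and> smooth_fun A u \<and> \<theta> \<ge> 0 \<and>
    (\<forall>(U, c)\<in>A. \<forall>x\<in>c ` U.
       let G = components g (U, c); h' = h \<circ> inv_into U c; u' = u \<circ> inv_into U c in
         (\<forall>v w. ricci G x v w + hess G h' x v w - \<theta> * (dir_deriv u' v x * dir_deriv u' w x)
                = lam * G x v w) \<and>
         laplacian G u' x - G x (grad G u' x) (grad G h' x) = 0)"

end

theory Submission
  imports Defs
begin

text \<open>
  Write the base as a Euclidean space with the involution \<open>J\<close> that multiplies the \<open>i\<close>-th coordinate by
  \<open>\<epsilon>\<^sub>i\<close>, so that \<open>g\<^sub>0(v, w) = J v \<bullet> w\<close>, \<open>\<xi>(x) = \<alpha> \<bullet> x\<close> has \<open>g\<^sub>0\<close>-gradient \<open>J \<alpha>\<close> and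
  \<open>\<parallel>\<alpha>\<parallel>\<^sup>2 = J \<alpha> \<bullet> \<alpha>\<close>. In a product chart the metric is
  \<open>\<phi>(\<xi>)\<^sup>-\<^sup>2 (J v\<^sub>1 \<bullet> w\<^sub>1) + f(\<xi>)\<^sup>2 k(v\<^sub>2, w\<^sub>2)\<close>, where \<open>k\<close> are the components of the fibre metric.
  The Koszul formula is then solved by an explicit vector (\<open>total_christoffel\<close>); differentiating it
  and taking the trace over the base and the fibre directions separately gives (\<open>total_ricci\<close>)
  \<open>Ric(v, w) = a (\<alpha> \<bullet> v\<^sub>1)(\<alpha> \<bullet> w\<^sub>1) + b (J v\<^sub>1 \<bullet> w\<^sub>1) + Ric\<^sub>k(v\<^sub>2, w\<^sub>2) - c k(v\<^sub>2, w\<^sub>2)\<close>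
  with \<open>a\<close>, \<open>b\<close>, \<open>c\<close> functions of \<open>\<xi>\<close>. The Hessian of a function of \<open>\<xi>\<close> has the same shape
  (\<open>total_hess\<close>), and the Laplacian and the gradient are read off from it.

  Hence the soliton equation at a point says that
  \<open>A (\<alpha> \<bullet> v\<^sub>1)(\<alpha> \<bullet> w\<^sub>1) + B (J v\<^sub>1 \<bullet> w\<^sub>1) + Ric\<^sub>k(v\<^sub>2, w\<^sub>2) - M k(v\<^sub>2, w\<^sub>2) = 0\<close> for all tangent vectors.
  As the base has dimension at least two, there is \<open>v\<^sub>1 \<noteq> 0\<close> orthogonal to \<open>\<alpha>\<close>, and testing with it
  forces \<open>B = 0\<close>, then \<open>A = 0\<close>: these are the first two equations. What is left is
  \<open>Ric\<^sub>k = M k\<close> (\<open>soliton_iff\<close>). Here \<open>M\<close> depends only on \<open>\<xi>\<close> and the rest only on the point of the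
  fibre, so \<open>M\<close> is a constant \<open>\<mu>\<close>, which is the third equation; the fourth one is the harmonic map
  equation. Conversely the equations give back the soliton identity in each product chart, and it
  remains to verify that the warped product is a semi-Riemannian manifold at all.
\<close>

section \<open>Calculus of smooth functions\<close>

lemma dir_deriv_eq: "(f has_derivative D) (at x) \<Longrightarrow> dir_deriv f v x = D v"
  by (metis frechet_derivative_at)

lemma has_dir_deriv:
  "f differentiable (at x) \<Longrightarrow> (f has_derivative (\<lambda>v. dir_deriv f v x)) (at x)"
  by (simp add: frechet_derivative_works)

lemma has_derivative_cong_open:
  assumes "open S" "x \<in> S" "\<And>y. y \<in> S \<Longrightarrow> f y = g y"
  shows "(f has_derivative D) (at x) \<longleftrightarrow> (g has_derivative D) (at x)"
  using assms has_derivative_transform_within_open[of f D x UNIV S g]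
    has_derivative_transform_within_open[of g D x UNIV S f] by auto

lemma dir_deriv_transform:
  assumes "open S" "x \<in> S" "\<And>y. y \<in> S \<Longrightarrow> f y = g y"
  shows "dir_deriv f v x = dir_deriv g v x"
  unfolding frechet_derivative_def using has_derivative_cong_open[OF assms] by simp

lemma differentiable_transform_open:
  assumes "open S" "x \<in> S" "\<And>y. y \<in> S \<Longrightarrow> f y = g y"
  shows "f differentiable (at x) \<longleftrightarrow> g differentiable (at x)"
  unfolding differentiable_def using has_derivative_cong_open[OF assms] by simp

lemma Ck_on_cong:
  assumes "open S" "\<And>x. x \<in> S \<Longrightarrow> f x = g x"
  shows "Ck_on k f S \<longleftrightarrow> Ck_on k g S"
  using assms(2)
proof (induction k arbitrary: f g)
  case 0
  then show ?case by (simp cong: continuous_on_cong)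
next
  case (Suc k)
  have "f differentiable (at x) \<longleftrightarrow> g differentiable (at x)" if "x \<in> S" for x
    by (rule differentiable_transform_open[OF assms(1) that Suc.prems])
  moreover have "Ck_on k (dir_deriv f v) S \<longleftrightarrow> Ck_on k (dir_deriv g v) S" for v
    by (rule Suc.IH) (rule dir_deriv_transform[OF assms(1)], use Suc.prems in auto)
  ultimately show ?case by simp
qed

lemma Ck_on_SucD: "Ck_on (Suc k) f S \<Longrightarrow> Ck_on k f S"
proof (induction k arbitrary: f)
  case 0
  then show ?case
    by (auto intro!: continuous_at_imp_continuous_on differentiable_imp_continuous_within)
next
  case (Suc k)
  then show ?case by (metis Ck_on.simps(2))
qed

lemma Ck_on_SucI:
  assumes "open S" "\<And>x. x \<in> S \<Longrightarrow> (f has_derivative D x) (at x)"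
    "\<And>v. Ck_on k (\<lambda>x. D x v) S"
  shows "Ck_on (Suc k) f S"
proof -
  have "Ck_on k (dir_deriv f v) S" for v
    using Ck_on_cong[OF assms(1), of "dir_deriv f v" "\<lambda>x. D x v"] dir_deriv_eq assms(2,3) by metis
  then show ?thesis using assms(2) by (auto simp: differentiable_def)
qed

lemma Ck_on_const: "open S \<Longrightarrow> Ck_on k (\<lambda>x. c) S"
proof (induction k arbitrary: c)
  case (Suc k)
  show ?case by (rule Ck_on_SucI[OF Suc.prems has_derivative_const]) (rule Suc.IH[OF Suc.prems])
qed simp

lemma Ck_on_linear:
  assumes "open S" "bounded_linear L" shows "Ck_on k L S"
proof (cases k)
  case (Suc l)
  show ?thesis
    unfolding Suc by (rule Ck_on_SucI[OF assms(1) bounded_linear_imp_has_derivative[OF assms(2)]])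
      (rule Ck_on_const[OF assms(1)])
qed (simp add: assms(2) linear_continuous_on)

lemma Ck_on_compose_linear:
  assumes "open T" "bounded_linear L" "L ` T \<subseteq> S" "Ck_on k f S"
  shows "Ck_on k (\<lambda>x. f (L x)) T"
  using assms(4)
proof (induction k arbitrary: f)
  case 0
  then show ?case
    using continuous_on_compose2[of S f T L] assms(2,3) linear_continuous_on by auto
next
  case (Suc k)
  show ?case
  proof (rule Ck_on_SucI[OF assms(1)])
    fix x assume "x \<in> T"
    then have "f differentiable (at (L x))" using assms(3) Suc.prems by auto
    from has_dir_deriv[OF this] bounded_linear_imp_has_derivative[OF assms(2)]
    show "((\<lambda>x. f (L x)) has_derivative (\<lambda>v. dir_deriv f (L v) (L x))) (at x)"
      by (rule has_derivative_compose[rotated])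
  next
    fix v show "Ck_on k (\<lambda>x. dir_deriv f (L v) (L x)) T"
      using Suc by auto
  qed
qed

lemma Ck_on_Pair:
  assumes "open S" "Ck_on k f S" "Ck_on k g S"
  shows "Ck_on k (\<lambda>x. (f x, g x)) S"
  using assms(2,3)
proof (induction k arbitrary: f g)
  case 0
  then show ?case by (simp add: continuous_on_Pair)
next
  case (Suc k)
  show ?case
    by (rule Ck_on_SucI[OF assms(1), where D="\<lambda>x v. (dir_deriv f v x, dir_deriv g v x)"])
      (use Suc in \<open>auto intro!: has_derivative_Pair has_dir_deriv Suc.IH\<close>)
qed

lemma Ck_on_add:
  assumes "open S" "Ck_on k f S" "Ck_on k g S"
  shows "Ck_on k (\<lambda>x. f x + g x) S"
  using assms(2,3)
proof (induction k arbitrary: f g)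
  case 0
  then show ?case by (simp add: continuous_on_add)
next
  case (Suc k)
  show ?case
    by (rule Ck_on_SucI[OF assms(1), where D="\<lambda>x v. dir_deriv f v x + dir_deriv g v x"])
      (use Suc in \<open>auto intro!: has_derivative_add has_dir_deriv Suc.IH\<close>)
qed

lemma Ck_on_mult:
  fixes f g :: "_ \<Rightarrow> real"
  assumes "open S" "Ck_on k f S" "Ck_on k g S"
  shows "Ck_on k (\<lambda>x. f x * g x) S"
  using assms(2,3)
proof (induction k arbitrary: f g)
  case 0
  then show ?case by (simp add: continuous_on_mult)
next
  case (Suc k)
  show ?case
    by (rule Ck_on_SucI[OF assms(1), where D="\<lambda>x v. f x * dir_deriv g v x + dir_deriv f v x * g x"])
      (use Suc Suc.prems[THEN Ck_on_SucD] in
        \<open>auto intro!: has_derivative_mult has_dir_deriv Suc.IH Ck_on_add assms(1)\<close>)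
qed

lemma Ck_on_inverse:
  fixes f :: "_ \<Rightarrow> real"
  assumes "open S" "Ck_on k f S" "\<And>x. x \<in> S \<Longrightarrow> f x \<noteq> 0"
  shows "Ck_on k (\<lambda>x. inverse (f x)) S"
  using assms(2)
proof (induction k)
  case 0
  then show ?case using assms(3) by (simp add: continuous_on_inverse)
next
  case (Suc k)
  have inv: "Ck_on k (\<lambda>x. inverse (f x)) S" using Suc Ck_on_SucD by blast
  show ?case
  proof (rule Ck_on_SucI[OF assms(1)])
    fix x assume x: "x \<in> S"
    show "((\<lambda>x. inverse (f x)) has_derivative
      (\<lambda>v. - 1 * (inverse (f x) * dir_deriv f v x * inverse (f x)))) (at x)"
      using Deriv.has_derivative_inverse[OF assms(3)[OF x] has_dir_deriv[of f x]] Suc.prems x by auto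
  next
    fix v
    have "Ck_on k (dir_deriv f v) S" using Suc.prems by simp
    then show "Ck_on k (\<lambda>x. - 1 * (inverse (f x) * dir_deriv f v x * inverse (f x))) S"
      by (intro Ck_on_mult Ck_on_const assms(1) inv)
  qed
qed

lemma smooth_on_cong:
  "open S \<Longrightarrow> (\<And>x. x \<in> S \<Longrightarrow> f x = g x) \<Longrightarrow> smooth_on f S \<longleftrightarrow> smooth_on g S"
  unfolding smooth_on_def using Ck_on_cong by blast

lemma smooth_on_differentiable:
  "smooth_on f S \<Longrightarrow> x \<in> S \<Longrightarrow> f differentiable (at x)"
  unfolding smooth_on_def by (metis Ck_on.simps(2))

lemma smooth_on_dir_deriv: "smooth_on f S \<Longrightarrow> smooth_on (dir_deriv f v) S"
  unfolding smooth_on_def by (metis Ck_on.simps(2))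

lemma smooth_on_compose_linear:
  "open T \<Longrightarrow> bounded_linear L \<Longrightarrow> L ` T \<subseteq> S \<Longrightarrow> smooth_on f S \<Longrightarrow> smooth_on (\<lambda>x. f (L x)) T"
  unfolding smooth_on_def using Ck_on_compose_linear by blast

lemma smooth_on_real_deriv:
  fixes f :: "real \<Rightarrow> real"
  assumes "smooth_on f UNIV"
  shows "(f has_real_derivative deriv f t) (at t)" "smooth_on (deriv f) UNIV"
proof -
  have D: "(f has_real_derivative deriv f t) (at t)" for t
    using smooth_on_differentiable[OF assms, of t] DERIV_imp_deriv
    by (auto simp: real_differentiable_def)
  then show "(f has_real_derivative deriv f t) (at t)" .
  have "dir_deriv f 1 = deriv f"
    using dir_deriv_eq[OF D[unfolded has_field_derivative_def]] by (auto simp: fun_eq_iff)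
  then show "smooth_on (deriv f) UNIV" using smooth_on_dir_deriv[OF assms] by metis
qed

section \<open>Duality for nondegenerate bilinear forms\<close>

lemma sharp_eqI:
  assumes "bilinear b" "\<And>v. (\<And>w. b v w = 0) \<Longrightarrow> v = 0" "\<And>w. b v w = \<omega> w"
  shows "sharp b \<omega> = v"
  unfolding sharp_def
proof (rule the_equality)
  fix v' assume "\<forall>w. b v' w = \<omega> w"
  then have "b (v' - v) w = 0" for w using assms(1,3) by (simp add: bilinear_lsub)
  then show "v' = v" using assms(2)[of "v' - v"] by simp
qed (use assms in auto)

text \<open>Existence of the dual vector: in finite dimension the injective map \<open>v \<mapsto> b v\<close> is onto.\<close>

lemma sharp_works:
  fixes b :: "'e::euclidean_space \<Rightarrow> 'e \<Rightarrow> real"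
  assumes b: "bilinear b" "\<And>v. (\<And>w. b v w = 0) \<Longrightarrow> v = 0" and "linear \<omega>"
  shows "b (sharp b \<omega>) w = \<omega> w"
proof -
  have eqI: "l = l'" if "linear l" "linear l'" "\<And>i. i \<in> Basis \<Longrightarrow> l i = l' i" for l l' :: "'e \<Rightarrow> real"
    using that linear_eq_on_span[of l l' Basis] by (auto simp: fun_eq_iff)
  have lin: "linear (b v)" for v using b(1) by (simp add: bilinear_def)
  define A where "A v = (\<Sum>i\<in>Basis. b v i *\<^sub>R i)" for v
  have A_i: "A v \<bullet> i = b v i" if "i \<in> Basis" for v i using that by (simp add: A_def)
  have "linear A"
    by (rule linearI) (auto simp: euclidean_eq_iff inner_add_left A_i
        bilinear_ladd[OF b(1)] bilinear_lmul[OF b(1)])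
  moreover have "inj A"
  proof (subst linear_injective_0[OF \<open>linear A\<close>], intro allI impI)
    fix v assume "A v = 0"
    then have "b v i = 0" if "i \<in> Basis" for i using A_i[OF that, of v] by simp
    then have "b v = (\<lambda>_. 0)" using eqI[OF lin, of "\<lambda>_. 0"] by (simp add: linear_iff)
    then show "v = 0" using b(2) by metis
  qed
  ultimately have "surj A" by (rule linear_inj_imp_surj)
  then obtain v where v: "A v = (\<Sum>i\<in>Basis. \<omega> i *\<^sub>R i)" by (metis surjE)
  have "b v = \<omega>"
    by (rule eqI[OF lin assms(3)]) (metis v A_i inner_sum_left_Basis)
  then show ?thesis using sharp_eqI[OF b, of v \<omega>] by simp
qed

section \<open>The Levi-Civita connection of a metric in coordinates\<close>

text \<open>The covector field \<open>g(\<nabla>\<^sub>v w, \<cdot>)\<close> given by the Koszul formula for constant fields \<open>v\<close>, \<open>w\<close>.\<close>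

abbreviation koszul :: "('e::euclidean_space \<Rightarrow> 'e \<Rightarrow> 'e \<Rightarrow> real) \<Rightarrow> 'e \<Rightarrow> 'e \<Rightarrow> 'e \<Rightarrow> 'e \<Rightarrow> real"
  where "koszul g x v w z \<equiv>
    (dir_deriv (\<lambda>y. g y w z) v x + dir_deriv (\<lambda>y. g y v z) w x - dir_deriv (\<lambda>y. g y v w) z x) / 2"

text \<open>The components of a differentiable semi-Riemannian metric on an open set; that its index is
  constant plays no role here.\<close>

locale local_metric =
  fixes W :: "'e::euclidean_space set" and k :: "'e \<Rightarrow> 'e \<Rightarrow> 'e \<Rightarrow> real"
  assumes open_W: "open W"
    and bil: "y \<in> W \<Longrightarrow> bilinear (k y)"
    and sym: "y \<in> W \<Longrightarrow> k y v w = k y w v"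
    and nondeg: "y \<in> W \<Longrightarrow> (\<And>w. k y v w = 0) \<Longrightarrow> v = 0"
    and diff: "y \<in> W \<Longrightarrow> (\<lambda>y. k y v w) differentiable (at y)"
begin

text \<open>The form \<open>k\<close> is only controlled on \<open>W\<close>, so identities between its values may be differentiated
  only because \<open>W\<close> is open.\<close>

lemma D_sym: "y \<in> W \<Longrightarrow> dir_deriv (\<lambda>y. k y v w) z y = dir_deriv (\<lambda>y. k y w v) z y"
  by (rule dir_deriv_transform[OF open_W]) (auto intro: sym)

lemma D_add_left:
  assumes "y \<in> W"
  shows "dir_deriv (\<lambda>y. k y (v + v') w) z y
    = dir_deriv (\<lambda>y. k y v w) z y + dir_deriv (\<lambda>y. k y v' w) z y"
proof -
  have "dir_deriv (\<lambda>y. k y (v + v') w) z y = dir_deriv (\<lambda>y. k y v w + k y v' w) z y"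
    using assms by (intro dir_deriv_transform[OF open_W]) (auto simp: bilinear_ladd[OF bil])
  also have "\<dots> = dir_deriv (\<lambda>y. k y v w) z y + dir_deriv (\<lambda>y. k y v' w) z y"
    by (rule dir_deriv_eq) (intro has_derivative_add has_dir_deriv diff assms)
  finally show ?thesis .
qed

lemma D_scale_left:
  assumes "y \<in> W"
  shows "dir_deriv (\<lambda>y. k y (c *\<^sub>R v) w) z y = c * dir_deriv (\<lambda>y. k y v w) z y"
proof -
  have "dir_deriv (\<lambda>y. k y (c *\<^sub>R v) w) z y = dir_deriv (\<lambda>y. c * k y v w) z y"
    using assms by (intro dir_deriv_transform[OF open_W]) (auto simp: bilinear_lmul[OF bil])
  also have "\<dots> = c * dir_deriv (\<lambda>y. k y v w) z y"
    by (rule dir_deriv_eq) (intro has_derivative_mult_right has_dir_deriv diff assms)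
  finally show ?thesis .
qed

lemma D_add_right:
  "y \<in> W \<Longrightarrow> dir_deriv (\<lambda>y. k y w (v + v')) z y
    = dir_deriv (\<lambda>y. k y w v) z y + dir_deriv (\<lambda>y. k y w v') z y"
  using D_add_left D_sym by metis

lemma D_scale_right:
  "y \<in> W \<Longrightarrow> dir_deriv (\<lambda>y. k y w (c *\<^sub>R v)) z y = c * dir_deriv (\<lambda>y. k y w v) z y"
  using D_scale_left D_sym by metis

lemma D_add_dir:
  "y \<in> W \<Longrightarrow> dir_deriv (\<lambda>y. k y v w) (z + z') y
    = dir_deriv (\<lambda>y. k y v w) z y + dir_deriv (\<lambda>y. k y v w) z' y"
  by (rule linear_add) (rule linear_frechet_derivative[OF diff])

lemma D_scale_dir:
  "y \<in> W \<Longrightarrow> dir_deriv (\<lambda>y. k y v w) (c *\<^sub>R z) y = c * dir_deriv (\<lambda>y. k y v w) z y"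
  using linear_frechet_derivative[OF diff, THEN linear_cmul] by simp

lemmas D_simps = D_add_left D_add_right D_add_dir D_scale_left D_scale_right D_scale_dir

lemma christoffel_koszul:
  assumes "y \<in> W" shows "k y (christoffel k y v w) z = koszul k y v w z"
  unfolding christoffel_def
  by (rule sharp_works[OF bil[OF assms]])
    (use nondeg[OF assms] in \<open>auto intro!: linearI simp: D_simps assms field_simps\<close>)

lemma christoffel_eqI:
  assumes "y \<in> W" "\<And>z. k y c z = koszul k y v w z"
  shows "christoffel k y v w = c"
  unfolding christoffel_def
  by (rule sharp_eqI[OF bil[OF assms(1)]]) (use assms nondeg in auto)

lemma christoffel_sym: "y \<in> W \<Longrightarrow> christoffel k y v w = christoffel k y w v"
  by (rule christoffel_eqI) (auto simp: christoffel_koszul D_sym[of y w v] algebra_simps)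

lemma christoffel_add_left:
  "y \<in> W \<Longrightarrow> christoffel k y (v + v') w = christoffel k y v w + christoffel k y v' w"
  by (rule christoffel_eqI)
    (auto simp: christoffel_koszul bilinear_ladd[OF bil] D_simps field_simps)

lemma christoffel_scale_left:
  "y \<in> W \<Longrightarrow> christoffel k y (c *\<^sub>R v) w = c *\<^sub>R christoffel k y v w"
  by (rule christoffel_eqI)
    (auto simp: christoffel_koszul bilinear_lmul[OF bil] D_simps field_simps)

lemma christoffel_add_right:
  "y \<in> W \<Longrightarrow> christoffel k y w (v + v') = christoffel k y w v + christoffel k y w v'"
  using christoffel_add_left christoffel_sym by metis

lemma christoffel_scale_right:
  "y \<in> W \<Longrightarrow> christoffel k y w (c *\<^sub>R v) = c *\<^sub>R christoffel k y w v"
  using christoffel_scale_left christoffel_sym by metis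

lemma christoffel_0:
  "y \<in> W \<Longrightarrow> christoffel k y w 0 = 0" "y \<in> W \<Longrightarrow> christoffel k y 0 w = 0"
  using christoffel_scale_right[of y w 0 0] christoffel_scale_left[of y 0 0 w] by auto

end

lemma differentiable_prod:
  fixes F :: "'i \<Rightarrow> 'e::real_normed_vector \<Rightarrow> real"
  assumes "finite I" "\<And>i. i \<in> I \<Longrightarrow> F i differentiable (at x)"
  shows "(\<lambda>y. \<Prod>i\<in>I. F i y) differentiable (at x)"
  using assms by (induction rule: finite_induct) (auto intro: differentiable_mult)

lemma differentiable_det:
  fixes M :: "'e::real_normed_vector \<Rightarrow> real ^ 'n ^ 'n"
  assumes "\<And>i j. (\<lambda>y. M y $ i $ j) differentiable (at x)"
  shows "(\<lambda>y. det (M y)) differentiable (at x)"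
  unfolding det_def
  by (intro differentiable_sum differentiable_mult differentiable_prod[OF finite] assms
      differentiable_const ballI) auto

text \<open>The Christoffel symbols solve a linear system whose coefficients are the components of the
  metric, so Cramer's rule expresses them as quotients of differentiable functions.\<close>

lemma christoffel_differentiable:
  fixes W :: "(real ^ 'm) set"
  assumes "local_metric W k"
    and smooth: "\<And>v w. smooth_on (\<lambda>y. k y v w) W" and y: "y \<in> W"
  shows "(\<lambda>y. christoffel k y v w) differentiable (at y)"
proof -
  interpret local_metric W k by fact
  define A :: "real ^ 'm \<Rightarrow> real ^ 'm ^ 'm"
    where "A = (\<lambda>y. \<chi> i j. k y (axis j 1) (axis i 1))"
  define r :: "real ^ 'm \<Rightarrow> real ^ 'm" where "r = (\<lambda>y. \<chi> i. koszul k y v w (axis i 1))"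
  define B where "B = (\<lambda>l y. \<chi> i j. if j = l then r y $ i else A y $ i $ j)"
  have A_mult: "A y *v c = (\<chi> i. k y c (axis i 1))" if "y \<in> W" for y c
  proof -
    have "k y c z = (\<Sum>j\<in>UNIV. k y (axis j 1) z * c $ j)" for z
    proof -
      have lin: "linear (\<lambda>c. k y c z)" using bil[OF that] by (simp add: bilinear_def)
      have "c = (\<Sum>j\<in>UNIV. c $ j *\<^sub>R axis j 1)"
        by (simp add: basis_expansion flip: scalar_mult_eq_scaleR)
      then have "k y c z = k y (\<Sum>j\<in>UNIV. c $ j *\<^sub>R axis j 1) z" by simp
      also have "\<dots> = (\<Sum>j\<in>UNIV. k y (axis j 1) z * c $ j)"
        by (simp add: linear_sum[OF lin] linear_cmul[OF lin] mult.commute)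
      finally show ?thesis .
    qed
    then show ?thesis by (simp add: A_def matrix_vector_mult_def)
  qed
  have det: "det (A y) \<noteq> 0" if "y \<in> W" for y
  proof -
    have "c = 0" if "A y *v c = 0" for c
    proof (rule nondeg[OF \<open>y \<in> W\<close>])
      fix z
      have lin: "linear (k y c)" using bil[OF \<open>y \<in> W\<close>] by (simp add: bilinear_def)
      have "k y c (axis i 1) = 0" for i
        using \<open>A y *v c = 0\<close> A_mult[OF \<open>y \<in> W\<close>, of c] by (simp add: vec_eq_iff)
      then have "k y c b = 0" if "b \<in> Basis" for b
        using that by (auto simp: Basis_vec_def)
      then show "k y c z = 0"
        using linear_eq_on_span[OF lin, of "\<lambda>_. 0" Basis z] by (simp add: linear_iff)
    qed
    then have "invertible (A y)"
      using matrix_left_invertible_ker[of "A y"] invertible_left_inverse[of "A y"] by blast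
    then show ?thesis by (simp add: invertible_det_nz)
  qed
  have sol: "christoffel k y v w = (\<chi> l. det (B l y) / det (A y))" if "y \<in> W" for y
  proof -
    have "A y *v christoffel k y v w = r y"
      by (simp add: A_mult[OF that] r_def christoffel_koszul[OF that])
    then show ?thesis using cramer[OF det[OF that]] by (simp add: B_def)
  qed
  have A_diff: "(\<lambda>y. A y $ i $ j) differentiable (at y)" for i j
    using smooth_on_differentiable[OF smooth y] by (simp add: A_def)
  have "(\<lambda>y. r y $ i) differentiable (at y)" for i
    using smooth_on_differentiable[OF smooth_on_dir_deriv[OF smooth] y]
    by (simp add: r_def)
  then have B_diff: "(\<lambda>y. B l y $ i $ j) differentiable (at y)" for l i j
    using A_diff by (cases "j = l") (simp_all add: B_def)
  have "(\<lambda>y. (\<chi> l. det (B l y) / det (A y)) \<bullet> b) differentiable (at y)" if b: "b \<in> Basis" for b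
  proof -
    obtain l where l: "b = axis l 1" using b by (auto simp: Basis_vec_def)
    have "(\<lambda>y. det (B l y) / det (A y)) differentiable (at y)"
      by (rule differentiable_divide[OF differentiable_det[OF B_diff] differentiable_det[OF A_diff]
            det[OF y]])
    then show ?thesis by (simp add: l inner_axis)
  qed
  then have "(\<lambda>y. \<chi> l. det (B l y) / det (A y)) differentiable (at y)"
    using differentiable_componentwise_within by blast
  then obtain D where D: "((\<lambda>y. \<chi> l. det (B l y) / det (A y)) has_derivative D) (at y)"
    unfolding differentiable_def by blast
  show ?thesis
    unfolding differentiable_def
    by (rule exI[of _ D], rule has_derivative_transform_within_open[OF D open_W y]) (simp add: sol)
qed

section \<open>Connection, Ricci curvature and Hessian of the warped product metric\<close>

text \<open>Functions of the base that depend on \<open>\<alpha> \<bullet> x\<close> alone are called ridge functions in lemma names.\<close>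

lemma has_derivative_ridge:
  assumes "(F has_real_derivative F') (at (\<alpha> \<bullet> fst z))"
  shows "((\<lambda>z. F (\<alpha> \<bullet> fst z)) has_derivative (\<lambda>u. F' * (\<alpha> \<bullet> fst u))) (at z)"
  by (rule has_derivative_compose[of "\<lambda>z. \<alpha> \<bullet> fst z"])
    (use assms in \<open>auto intro!: derivative_eq_intros simp: has_field_derivative_def\<close>)

lemma has_derivative_snd_comp:
  assumes "K differentiable (at (snd z))"
  shows "((\<lambda>z. K (snd z)) has_derivative (\<lambda>u. dir_deriv K (snd u) (snd z))) (at z)"
  by (rule has_derivative_compose[of snd, OF _ has_dir_deriv[OF assms]])
    (auto intro!: derivative_eq_intros)

lemma sum_Basis_prod:
  fixes F :: "'a::euclidean_space \<times> 'b::euclidean_space \<Rightarrow> real"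
  shows "sum F Basis = (\<Sum>b\<in>Basis. F (b, 0)) + (\<Sum>b\<in>Basis. F (0, b))"
  unfolding Basis_prod_def
  by (subst sum.union_disjoint)
    (auto simp: sum.reindex inj_on_def dest: nonzero_Basis)

lemma sum_Basis_inner: "(\<Sum>b\<in>Basis. (v \<bullet> b) * (w \<bullet> b)) = v \<bullet> w"
  by (rule euclidean_inner[symmetric])

lemma sum_Basis_inner_same: "(\<Sum>b\<in>(Basis :: 'e::euclidean_space set). b \<bullet> b) = real DIM('e)"
  by simp

text \<open>
  Components \<open>G\<close>, over \<open>UNIV \<times> W\<close>, of the warped product metric with base metric \<open>\<phi>\<^sup>-\<^sup>2 (J \<cdot> \<bullet> \<cdot>)\<close> and
  fibre metric \<open>k\<close>. The involution \<open>J\<close> encodes the signature of the base; \<open>\<phi>'\<close>, \<open>\<phi>''\<close>, \<open>f'\<close>, \<open>f''\<close> name the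
  derivatives. Nothing is assumed about \<open>G\<close> outside \<open>UNIV \<times> W\<close>. Second derivatives of \<open>k\<close> enter only through
  the differentiability of its Christoffel symbols.
\<close>

locale warped_metric = local_metric W k for W :: "'b::euclidean_space set" and k +
  fixes J :: "'a::euclidean_space \<Rightarrow> 'a" and \<alpha> :: 'a
    and \<phi> \<phi>' \<phi>'' f f' f'' :: "real \<Rightarrow> real"
    and G :: "'a \<times> 'b \<Rightarrow> 'a \<times> 'b \<Rightarrow> 'a \<times> 'b \<Rightarrow> real"
  assumes linJ: "linear J" and J_J: "J (J v) = v" and J_adj: "J v \<bullet> w = v \<bullet> J w"
    and phi': "(\<phi> has_real_derivative \<phi>' t) (at t)" and phi'': "(\<phi>' has_real_derivative \<phi>'' t) (at t)"
    and f': "(f has_real_derivative f' t) (at t)" and f'': "(f' has_real_derivative f'' t) (at t)"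
    and phi_pos: "\<phi> t > 0" and f_pos: "f t > 0"
    and G: "y \<in> W \<Longrightarrow> G (x, y) X Y =
      (J (fst X) \<bullet> fst Y) / (\<phi> (\<alpha> \<bullet> x))\<^sup>2 + (f (\<alpha> \<bullet> x))\<^sup>2 * k y (snd X) (snd Y)"
    and christ_diff: "y \<in> W \<Longrightarrow> (\<lambda>y. christoffel k y a b) differentiable (at y)"
begin

text \<open>\<open>E\<close> is the flat metric \<open>g\<^sub>0\<close> of the base and \<open>N\<close> is \<open>\<parallel>\<alpha>\<parallel>\<^sup>2\<close>.\<close>

abbreviation "E v w \<equiv> J v \<bullet> w"
abbreviation "N \<equiv> J \<alpha> \<bullet> \<alpha>"

lemma E_sym: "E v w = E w v" by (metis J_adj inner_commute)

lemmas J_simps = linear_add[OF linJ] linear_cmul[OF linJ] linear_diff[OF linJ] linear_0[OF linJ]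

lemmas pos [simp] = phi_pos[THEN less_imp_neq, symmetric] f_pos[THEN less_imp_neq, symmetric]

lemma open_S: "open ((UNIV :: 'a set) \<times> W)" by (simp add: open_Times open_W)

lemma G_has_derivative:
  assumes "y \<in> W"
  shows "((\<lambda>z. G z v w) has_derivative (\<lambda>u.
     - 2 * \<phi>' (\<alpha> \<bullet> x) / (\<phi> (\<alpha> \<bullet> x)) ^ 3 * (\<alpha> \<bullet> fst u) * E (fst v) (fst w)
     + 2 * f (\<alpha> \<bullet> x) * f' (\<alpha> \<bullet> x) * (\<alpha> \<bullet> fst u) * k y (snd v) (snd w)
     + (f (\<alpha> \<bullet> x))\<^sup>2 * dir_deriv (\<lambda>y. k y (snd v) (snd w)) (snd u) y)) (at (x, y))" (is "(_ has_derivative ?D) _")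
proof -
  let ?t = "\<alpha> \<bullet> x"
  have 1: "((\<lambda>t. 1 / (\<phi> t)\<^sup>2) has_real_derivative - 2 * \<phi>' ?t / (\<phi> ?t) ^ 3) (at (\<alpha> \<bullet> fst (x, y)))"
    using phi' by (auto intro!: derivative_eq_intros simp: power2_eq_square power3_eq_cube field_simps)
  have 2: "((\<lambda>t. (f t)\<^sup>2) has_real_derivative 2 * f ?t * f' ?t) (at (\<alpha> \<bullet> fst (x, y)))"
    using f' by (auto intro!: derivative_eq_intros)
  have 3: "(\<lambda>y. k y (snd v) (snd w)) differentiable (at (snd (x, y)))" using diff assms by simp
  have "((\<lambda>z. 1 / (\<phi> (\<alpha> \<bullet> fst z))\<^sup>2 * E (fst v) (fst w)
      + (f (\<alpha> \<bullet> fst z))\<^sup>2 * k (snd z) (snd v) (snd w)) has_derivative ?D) (at (x, y))"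
    by (rule has_derivative_eq_rhs, rule has_derivative_add[OF has_derivative_mult_left
          [OF has_derivative_ridge[OF 1]] has_derivative_mult[OF has_derivative_ridge[OF 2]
          has_derivative_snd_comp[OF 3]]])
      (auto simp: algebra_simps)
  then show ?thesis
    by (rule has_derivative_transform_within_open[OF _ open_S]) (use assms in \<open>auto simp: G\<close>)
qed

sublocale total: local_metric "UNIV \<times> W" G
proof
  show "open ((UNIV :: 'a set) \<times> W)" by (rule open_S)
  fix z :: "'a \<times> 'b" and v w assume "z \<in> UNIV \<times> W"
  then obtain x y where z: "z = (x, y)" "y \<in> W" by auto
  note [simp] = bilinear_ladd[OF bil[OF z(2)]] bilinear_radd[OF bil[OF z(2)]]
    bilinear_lmul[OF bil[OF z(2)]] bilinear_rmul[OF bil[OF z(2)]]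
    bilinear_lzero[OF bil[OF z(2)]] bilinear_rzero[OF bil[OF z(2)]]
  show "bilinear (G z)"
    by (auto simp: bilinear_def z G J_simps inner_add_left inner_add_right field_simps intro!: linearI)
  show "G z v w = G z w v"
    by (simp add: z G E_sym[of "fst v"] sym[OF z(2), of "snd v"])
  show "(\<lambda>z. G z v w) differentiable (at z)"
    unfolding z(1) differentiable_def by (rule exI, rule G_has_derivative[OF z(2)])
  assume *: "\<And>w. G z v w = 0"
  have "J (fst v) = 0"
    using *[of "(J (fst v), 0)"] by (simp add: z G)
  then have "fst v = 0" using J_J[of "fst v"] by (simp add: J_simps)
  moreover have "snd v = 0"
  proof (rule nondeg[OF z(2)])
    show "k y (snd v) w = 0" for w using *[of "(0, w)"] by (simp add: z G)
  qed
  ultimately show "v = 0" by (simp add: prod_eq_iff)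
qed

text \<open>The first component is the connection of the conformally flat base, corrected by the normal
  part \<open>- f k(v\<^sub>2, w\<^sub>2) \<nabla>f\<close>; the second is the connection of the fibre plus the mixed terms
  \<open>(v\<^sub>1 f / f) w\<^sub>2 + (w\<^sub>1 f / f) v\<^sub>2\<close>.\<close>

lemma total_christoffel:
  assumes "y \<in> W"
  shows "christoffel G (x, y) v w =
    (- (\<phi>' (\<alpha> \<bullet> x) / \<phi> (\<alpha> \<bullet> x)) *\<^sub>R
        ((\<alpha> \<bullet> fst v) *\<^sub>R fst w + (\<alpha> \<bullet> fst w) *\<^sub>R fst v - E (fst v) (fst w) *\<^sub>R J \<alpha>)
      - ((\<phi> (\<alpha> \<bullet> x))\<^sup>2 * f (\<alpha> \<bullet> x) * f' (\<alpha> \<bullet> x) * k y (snd v) (snd w)) *\<^sub>R J \<alpha>,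
     christoffel k y (snd v) (snd w) + (f' (\<alpha> \<bullet> x) / f (\<alpha> \<bullet> x)) *\<^sub>R
        ((\<alpha> \<bullet> fst v) *\<^sub>R snd w + (\<alpha> \<bullet> fst w) *\<^sub>R snd v))"
proof (rule total.christoffel_eqI)
  fix z :: "'a \<times> 'b"
  let ?t = "\<alpha> \<bullet> x"
  note b [simp] = bilinear_ladd[OF bil[OF assms]] bilinear_lmul[OF bil[OF assms]]
  have *: "dir_deriv (\<lambda>z. G z v w) u (x, y) =
     - 2 * \<phi>' ?t / (\<phi> ?t) ^ 3 * (\<alpha> \<bullet> fst u) * E (fst v) (fst w)
     + 2 * f ?t * f' ?t * (\<alpha> \<bullet> fst u) * k y (snd v) (snd w)
     + (f ?t)\<^sup>2 * dir_deriv (\<lambda>y. k y (snd v) (snd w)) (snd u) y" for u v w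
    by (rule dir_deriv_eq[OF G_has_derivative[OF assms]])
  have K: "dir_deriv (\<lambda>y. k y (snd v) (snd w)) (snd z) y
      = dir_deriv (\<lambda>y. k y (snd w) (snd z)) (snd v) y + dir_deriv (\<lambda>y. k y (snd v) (snd z)) (snd w) y
        - 2 * k y (christoffel k y (snd v) (snd w)) (snd z)"
    using christoffel_koszul[OF assms, of "snd v" "snd w" "snd z"] by simp
  show "G (x, y) (- (\<phi>' (\<alpha> \<bullet> x) / \<phi> (\<alpha> \<bullet> x)) *\<^sub>R
        ((\<alpha> \<bullet> fst v) *\<^sub>R fst w + (\<alpha> \<bullet> fst w) *\<^sub>R fst v - E (fst v) (fst w) *\<^sub>R J \<alpha>)
      - ((\<phi> (\<alpha> \<bullet> x))\<^sup>2 * f (\<alpha> \<bullet> x) * f' (\<alpha> \<bullet> x) * k y (snd v) (snd w)) *\<^sub>R J \<alpha>,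
     christoffel k y (snd v) (snd w) + (f' (\<alpha> \<bullet> x) / f (\<alpha> \<bullet> x)) *\<^sub>R
        ((\<alpha> \<bullet> fst v) *\<^sub>R snd w + (\<alpha> \<bullet> fst w) *\<^sub>R snd v)) z = koszul G (x, y) v w z"
    by (simp add: * K G assms J_simps J_J inner_diff_left inner_add_left sym[OF assms, of "snd z"]
        E_sym[of "fst z"] power2_eq_square power3_eq_cube field_simps)
qed (use assms in auto)

lemma total_christoffel_has_derivative:
  fixes x :: 'a
  assumes y: "y \<in> W"
  defines "t \<equiv> \<alpha> \<bullet> x"
  shows "((\<lambda>z. christoffel G z v w) has_derivative (\<lambda>u.
    (- ((\<phi>'' t / \<phi> t - (\<phi>' t / \<phi> t)\<^sup>2) * (\<alpha> \<bullet> fst u)) *\<^sub>R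
        ((\<alpha> \<bullet> fst v) *\<^sub>R fst w + (\<alpha> \<bullet> fst w) *\<^sub>R fst v - E (fst v) (fst w) *\<^sub>R J \<alpha>)
      - ((2 * \<phi> t * \<phi>' t * f t * f' t + (\<phi> t)\<^sup>2 * ((f' t)\<^sup>2 + f t * f'' t)) * (\<alpha> \<bullet> fst u)
            * k y (snd v) (snd w)
          + (\<phi> t)\<^sup>2 * f t * f' t * dir_deriv (\<lambda>y. k y (snd v) (snd w)) (snd u) y) *\<^sub>R J \<alpha>,
     dir_deriv (\<lambda>y. christoffel k y (snd v) (snd w)) (snd u) y
      + ((f'' t / f t - (f' t / f t)\<^sup>2) * (\<alpha> \<bullet> fst u)) *\<^sub>R
        ((\<alpha> \<bullet> fst v) *\<^sub>R snd w + (\<alpha> \<bullet> fst w) *\<^sub>R snd v)))) (at (x, y))"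
    (is "(_ has_derivative ?D) _")
proof -
  let ?z = "(x, y)"
  let ?b = "(\<alpha> \<bullet> fst v) *\<^sub>R fst w + (\<alpha> \<bullet> fst w) *\<^sub>R fst v - E (fst v) (fst w) *\<^sub>R J \<alpha>"
  let ?m = "(\<alpha> \<bullet> fst v) *\<^sub>R snd w + (\<alpha> \<bullet> fst w) *\<^sub>R snd v"
  have 1: "((\<lambda>t. - (\<phi>' t / \<phi> t)) has_real_derivative - (\<phi>'' t / \<phi> t - (\<phi>' t / \<phi> t)\<^sup>2))
      (at (\<alpha> \<bullet> fst ?z))"
    using phi' phi'' unfolding t_def
    by (auto intro!: derivative_eq_intros simp: power2_eq_square field_simps)
  have 2: "((\<lambda>t. (\<phi> t)\<^sup>2 * f t * f' t) has_real_derivative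
      2 * \<phi> t * \<phi>' t * f t * f' t + (\<phi> t)\<^sup>2 * ((f' t)\<^sup>2 + f t * f'' t)) (at (\<alpha> \<bullet> fst ?z))"
    using phi' f' f'' unfolding t_def
    by (auto intro!: derivative_eq_intros simp: power2_eq_square field_simps)
  have 3: "((\<lambda>t. f' t / f t) has_real_derivative (f'' t / f t - (f' t / f t)\<^sup>2)) (at (\<alpha> \<bullet> fst ?z))"
    using f' f'' unfolding t_def
    by (auto intro!: derivative_eq_intros simp: power2_eq_square field_simps)
  have 4: "(\<lambda>y. k y (snd v) (snd w)) differentiable (at (snd ?z))" using diff y by simp
  have 5: "(\<lambda>y. christoffel k y (snd v) (snd w)) differentiable (at (snd ?z))"
    using christ_diff y by simp
  have "((\<lambda>z. (- (\<phi>' (\<alpha> \<bullet> fst z) / \<phi> (\<alpha> \<bullet> fst z)) *\<^sub>R ?b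
      - ((\<phi> (\<alpha> \<bullet> fst z))\<^sup>2 * f (\<alpha> \<bullet> fst z) * f' (\<alpha> \<bullet> fst z) * k (snd z) (snd v) (snd w)) *\<^sub>R J \<alpha>,
     christoffel k (snd z) (snd v) (snd w) + (f' (\<alpha> \<bullet> fst z) / f (\<alpha> \<bullet> fst z)) *\<^sub>R ?m))
     has_derivative ?D) (at ?z)"
    by (rule has_derivative_eq_rhs, rule has_derivative_Pair[OF
          has_derivative_diff[OF
            has_derivative_scaleR_left[OF has_derivative_ridge[OF 1]]
            has_derivative_scaleR_left[OF has_derivative_mult[OF has_derivative_ridge[OF 2]
              has_derivative_snd_comp[OF 4]]]]
          has_derivative_add[OF has_derivative_snd_comp[OF 5]
            has_derivative_scaleR_left[OF has_derivative_ridge[OF 3]]]])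
      (simp add: t_def fun_eq_iff algebra_simps)
  then show ?thesis
    by (rule has_derivative_transform_within_open[OF _ open_S])
      (use y in \<open>auto simp: total_christoffel\<close>)
qed

lemmas dir_deriv_total_christoffel = dir_deriv_eq[OF total_christoffel_has_derivative]

lemma D_0: "y \<in> W \<Longrightarrow> dir_deriv (\<lambda>y. k y 0 w) u y = 0"
  using D_scale_left[of y 0 0 w u] by simp

lemma D_dir_0: "y \<in> W \<Longrightarrow> dir_deriv (\<lambda>y. k y v w) 0 y = 0"
  using D_scale_dir[of y v w 0 0] by simp

lemma dir_christoffel_0: "y \<in> W \<Longrightarrow> dir_deriv (\<lambda>y. christoffel k y 0 w) u y = 0"
  using dir_deriv_transform[OF open_W, of y "\<lambda>y. christoffel k y 0 w" "\<lambda>y. 0"]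
  by (simp add: christoffel_0)

text \<open>The terms of the Ricci trace, for base directions \<open>b\<close> here and for fibre directions below. They are
  arranged as multiples of products of two inner products with \<open>b\<close>, so that summing over an
  orthonormal basis is Parseval's identity.\<close>

lemma riemann_base_direction:
  fixes x :: 'a
  assumes y: "y \<in> W" and c: "christoffel G (x, y) v w = (c1, c2)"
  defines "t \<equiv> \<alpha> \<bullet> x"
  defines "p \<equiv> \<phi>' t / \<phi> t" and "p' \<equiv> \<phi>'' t / \<phi> t - (\<phi>' t / \<phi> t)\<^sup>2"
    and "s \<equiv> f' t / f t" and "q \<equiv> (\<phi> t)\<^sup>2 * f t * f' t"
    and "q' \<equiv> 2 * \<phi> t * \<phi>' t * f t * f' t + (\<phi> t)\<^sup>2 * ((f' t)\<^sup>2 + f t * f'' t)"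
    and "av \<equiv> \<alpha> \<bullet> fst v" and "aw \<equiv> \<alpha> \<bullet> fst w" and "K \<equiv> k y (snd v) (snd w)"
    and "V \<equiv> E (fst v) (fst w)"
  shows "fst (riemann G (x, y) (b, 0) v w) \<bullet> b =
     - p\<^sup>2 * av * ((\<alpha> \<bullet> b) * (fst w \<bullet> b))
     - (p' + 2 * p\<^sup>2) * aw * ((\<alpha> \<bullet> b) * (fst v \<bullet> b))
     + ((p' + p\<^sup>2) * V + (q * s - q') * K) * ((\<alpha> \<bullet> b) * (J \<alpha> \<bullet> b))
     + ((p' - p\<^sup>2) * av * aw - p * (\<alpha> \<bullet> c1)) * (b \<bullet> b)
     - p' * av * ((J (fst w) \<bullet> b) * (J \<alpha> \<bullet> b))
     - p * ((\<alpha> \<bullet> b) * (c1 \<bullet> b)) + p * ((J c1 \<bullet> b) * (J \<alpha> \<bullet> b))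
     + p\<^sup>2 * N * ((J (fst w) \<bullet> b) * (fst v \<bullet> b)) + p\<^sup>2 * aw * ((J (fst v) \<bullet> b) * (J \<alpha> \<bullet> b))"
proof -
  have Eb: "E b v = J v \<bullet> b" for v using E_sym by simp
  have Ja: "\<alpha> \<bullet> J v = J \<alpha> \<bullet> v" "J u \<bullet> J v = u \<bullet> v" for u v
    by (simp_all add: J_adj J_J)
  show ?thesis
    unfolding riemann_def c
    by (simp add: dir_deriv_total_christoffel[OF y] total_christoffel[OF y] y D_0 D_dir_0 dir_christoffel_0
        christoffel_0 bilinear_lzero[OF bil] bilinear_rmul[OF bil]
        inner_add_left inner_diff_left inner_add_right inner_diff_right Eb Ja
        flip: t_def p_def p'_def s_def q_def q'_def av_def aw_def K_def V_def)
      (simp add: algebra_simps p'_def p_def power2_eq_square Eb inner_commute av_def aw_def V_def)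
qed

lemma riemann_fibre_direction:
  fixes x :: 'a and v w :: "'a \<times> 'b"
  assumes y: "y \<in> W"
  defines "t \<equiv> \<alpha> \<bullet> x"
  defines "p \<equiv> \<phi>' t / \<phi> t" and "s \<equiv> f' t / f t" and "q \<equiv> (\<phi> t)\<^sup>2 * f t * f' t"
    and "av \<equiv> \<alpha> \<bullet> fst v" and "aw \<equiv> \<alpha> \<bullet> fst w"
  shows "snd (riemann G (x, y) (0, b) v w) \<bullet> b =
     riemann k y b (snd v) (snd w) \<bullet> b
     + (s * (\<alpha> \<bullet> fst (christoffel G (x, y) v w)) - f'' t / f t * av * aw) * (b \<bullet> b)
     + s * q * N * (k y b (snd w) * (snd v \<bullet> b))"
proof -
  define c1 c2 where "c1 = fst (christoffel G (x, y) v w)"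
    and "c2 = christoffel k y (snd v) (snd w) + s *\<^sub>R (av *\<^sub>R snd w + aw *\<^sub>R snd v)"
  have c: "christoffel G (x, y) v w = (c1, c2)"
    by (simp add: c1_def c2_def total_christoffel[OF y] t_def s_def av_def aw_def)
  have Ja: "\<alpha> \<bullet> J v = J \<alpha> \<bullet> v" for v
    by (simp add: J_adj)
  have bsym: "christoffel k y v b = christoffel k y b v" for v
    by (rule christoffel_sym[OF y])
  show ?thesis
    unfolding riemann_def c fst_conv
    by (simp add: dir_deriv_total_christoffel[OF y] total_christoffel[OF y] y D_0 D_dir_0
        dir_christoffel_0 christoffel_0 bilinear_lzero[OF bil] bilinear_rmul[OF bil]
        christoffel_add_right christoffel_scale_right c2_def bsym
        inner_add_left inner_diff_left inner_add_right inner_diff_right Ja linear_0[OF linJ]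
        flip: t_def p_def s_def q_def av_def aw_def)
      (simp add: algebra_simps s_def power2_eq_square av_def aw_def q_def)
qed

text \<open>The only part of the connection that acts on ridge functions.\<close>

lemma alpha_christoffel:
  assumes "y \<in> W"
  shows "\<alpha> \<bullet> fst (christoffel G (x, y) v w) =
    - (\<phi>' (\<alpha> \<bullet> x) / \<phi> (\<alpha> \<bullet> x))
        * (2 * (\<alpha> \<bullet> fst v) * (\<alpha> \<bullet> fst w) - E (fst v) (fst w) * N)
      - (\<phi> (\<alpha> \<bullet> x))\<^sup>2 * f (\<alpha> \<bullet> x) * f' (\<alpha> \<bullet> x) * k y (snd v) (snd w) * N"
  by (simp add: total_christoffel[OF assms] inner_diff_right inner_add_right inner_commute[of \<alpha> "J \<alpha>"]
      algebra_simps)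

lemma total_ricci:
  fixes x :: 'a
  assumes y: "y \<in> W"
  defines "t \<equiv> \<alpha> \<bullet> x" and "n \<equiv> real DIM('a)" and "m \<equiv> real DIM('b)"
  shows "ricci G (x, y) v w =
    ((n - 2) * (\<phi>'' t / \<phi> t) - m * (f'' t / f t) - 2 * m * (\<phi>' t / \<phi> t) * (f' t / f t))
      * ((\<alpha> \<bullet> fst v) * (\<alpha> \<bullet> fst w))
    + (\<phi>'' t / \<phi> t - (n - 1) * (\<phi>' t / \<phi> t)\<^sup>2 + m * (\<phi>' t / \<phi> t) * (f' t / f t))
      * N * E (fst v) (fst w)
    + ricci k y (snd v) (snd w)
    - (f'' t / f t - (n - 2) * (\<phi>' t / \<phi> t) * (f' t / f t) + (m - 1) * (f' t / f t)\<^sup>2)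
      * N * (f t)\<^sup>2 * (\<phi> t)\<^sup>2 * k y (snd v) (snd w)"
proof -
  obtain c1 c2 where c: "christoffel G (x, y) v w = (c1, c2)" by force
  have Ja: "\<alpha> \<bullet> J v = J \<alpha> \<bullet> v" "J u \<bullet> J v = u \<bullet> v" for u v
    by (simp_all add: J_adj J_J)
  have EE: "fst w \<bullet> J (fst v) = fst v \<bullet> J (fst w)" by (metis J_adj inner_commute)
  define av where "av = \<alpha> \<bullet> fst v"
  define aw where "aw = \<alpha> \<bullet> fst w"
  define V where "V = E (fst v) (fst w)"
  define K where "K = k y (snd v) (snd w)"
  define p where "p = \<phi>' t / \<phi> t"
  define p' where "p' = \<phi>'' t / \<phi> t - p\<^sup>2"
  define s where "s = f' t / f t"
  define s2 where "s2 = f'' t / f t"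
  define F where "F = (\<phi> t)\<^sup>2 * (f t)\<^sup>2"
  define ac where "ac = \<alpha> \<bullet> c1"
  have phi2: "\<phi>'' t / \<phi> t = p' + p\<^sup>2" by (simp add: p'_def)
  have q: "(\<phi> t)\<^sup>2 * f t * f' t = F * s" by (simp add: F_def s_def power2_eq_square)
  have q': "2 * \<phi> t * \<phi>' t * f t * f' t + (\<phi> t)\<^sup>2 * ((f' t)\<^sup>2 + f t * f'' t)
    = F * (2 * p * s + s\<^sup>2 + s2)"
    by (simp add: F_def s_def s2_def p_def power2_eq_square field_simps)
  have ac: "ac = - p * (2 * av * aw - V * N) - F * s * K * N"
    using alpha_christoffel[OF y, of x v w]
    by (simp add: c ac_def av_def aw_def V_def K_def p_def q[symmetric] t_def)
  have lin: "linear (\<lambda>v. k y v (snd w))" using bil[OF y] by (simp add: bilinear_def)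
  have K_sum: "(\<Sum>b\<in>Basis. k y b (snd w) * (snd v \<bullet> b)) = K"
  proof -
    have "K = k y (\<Sum>b\<in>Basis. (snd v \<bullet> b) *\<^sub>R b) (snd w)"
      by (simp add: K_def euclidean_representation)
    then show ?thesis by (simp add: linear_sum[OF lin] linear_cmul[OF lin] mult.commute)
  qed
  \<comment> \<open>\<open>ac\<close> is kept opaque while summing; its value is substituted only at the end.\<close>
  have 1: "(\<Sum>b\<in>Basis. fst (riemann G (x, y) (b, 0) v w) \<bullet> b)
    = - p\<^sup>2 * av * aw - (p' + 2 * p\<^sup>2) * aw * av
      + ((p' + p\<^sup>2) * V + (F * s * s - F * (2 * p * s + s\<^sup>2 + s2)) * K) * N
      + ((p' - p\<^sup>2) * av * aw - p * ac) * n
      - p' * av * aw - p * ac + p * ac + p\<^sup>2 * N * V + p\<^sup>2 * aw * av"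
    unfolding riemann_base_direction[OF y c] t_def[symmetric] q q'
    by (simp only: sum.distrib sum_subtractf sum_distrib_left[symmetric] sum_Basis_inner
        sum_Basis_inner_same Ja)
      (simp add: av_def aw_def V_def K_def ac_def n_def p_def p'_def s_def inner_commute EE)
  have 2: "(\<Sum>b\<in>Basis. snd (riemann G (x, y) (0, b) v w) \<bullet> b)
    = ricci k y (snd v) (snd w) + (s * ac - s2 * av * aw) * m + s * (F * s) * N * K"
    unfolding riemann_fibre_direction[OF y] t_def[symmetric] q
    by (simp only: sum.distrib sum_distrib_left[symmetric] K_sum ricci_def sum_Basis_inner_same)
      (simp add: av_def aw_def c ac_def m_def s_def s2_def)
  have "ricci G (x, y) v w = (\<Sum>b\<in>Basis. fst (riemann G (x, y) (b, 0) v w) \<bullet> b)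
     + (\<Sum>b\<in>Basis. snd (riemann G (x, y) (0, b) v w) \<bullet> b)"
    unfolding ricci_def sum_Basis_prod by (simp add: inner_prod_def)
  then show ?thesis
    unfolding 1 2 ac phi2 s2_def[symmetric] p_def[symmetric] s_def[symmetric] av_def[symmetric]
      aw_def[symmetric] V_def[symmetric] K_def[symmetric]
    by (simp add: F_def) (simp add: algebra_simps power2_eq_square)
qed

lemma ridge_dir_deriv:
  assumes "\<forall>x. \<forall>y\<in>W. H\<xi> (x, y) = H (\<alpha> \<bullet> x)"
    and "\<And>t. (H has_real_derivative H' t) (at t)" and "y \<in> W"
  shows "dir_deriv H\<xi> v (x, y) = H' (\<alpha> \<bullet> x) * (\<alpha> \<bullet> fst v)"
proof -
  have "dir_deriv H\<xi> v (x, y) = dir_deriv (\<lambda>z. H (\<alpha> \<bullet> fst z)) v (x, y)"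
    by (rule dir_deriv_transform[OF open_S]) (use assms in auto)
  also have "\<dots> = H' (\<alpha> \<bullet> x) * (\<alpha> \<bullet> fst v)"
    using dir_deriv_eq[OF has_derivative_ridge[of H "H' (\<alpha> \<bullet> x)" \<alpha> "(x, y)"]] assms(2) by simp
  finally show ?thesis .
qed

lemma total_hess:
  fixes x :: 'a
  assumes H\<xi>: "\<forall>x. \<forall>y\<in>W. H\<xi> (x, y) = H (\<alpha> \<bullet> x)"
    and H': "\<And>t. (H has_real_derivative H' t) (at t)"
    and H'': "\<And>t. (H' has_real_derivative H'' t) (at t)" and y: "y \<in> W"
  defines "t \<equiv> \<alpha> \<bullet> x"
  shows "hess G H\<xi> (x, y) v w =
    (H'' t + 2 * (\<phi>' t / \<phi> t) * H' t) * ((\<alpha> \<bullet> fst v) * (\<alpha> \<bullet> fst w))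
    + (- (\<phi>' t / \<phi> t) * H' t * N) * E (fst v) (fst w)
    + ((f' t / f t) * H' t * N * (f t)\<^sup>2 * (\<phi> t)\<^sup>2) * k y (snd v) (snd w)"
proof -
  have "dir_deriv (dir_deriv H\<xi> w) v (x, y) = H'' t * (\<alpha> \<bullet> fst v) * (\<alpha> \<bullet> fst w)"
  proof -
    have "dir_deriv (dir_deriv H\<xi> w) v (x, y) = dir_deriv (\<lambda>z. H' (\<alpha> \<bullet> fst z) * (\<alpha> \<bullet> fst w)) v (x, y)"
      by (rule dir_deriv_transform[OF open_S])
        (use y ridge_dir_deriv[where H\<xi>=H\<xi> and v=w, OF H\<xi> H'] in auto)
    also have "\<dots> = H'' t * (\<alpha> \<bullet> fst v) * (\<alpha> \<bullet> fst w)"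
      using dir_deriv_eq[OF has_derivative_mult_left[OF
          has_derivative_ridge[of H' "H'' (\<alpha> \<bullet> x)" \<alpha> "(x, y)"]]] H''
      by (simp add: t_def)
    finally show ?thesis .
  qed
  moreover have "(f' t / f t) * H' t * N * (f t)\<^sup>2 * (\<phi> t)\<^sup>2 = (\<phi> t)\<^sup>2 * f t * f' t * H' t * N"
    by (simp add: power2_eq_square)
  ultimately show ?thesis
    unfolding hess_def
    by (simp only: ridge_dir_deriv[where H\<xi>=H\<xi>, OF H\<xi> H' y] alpha_christoffel[OF y] flip: t_def)
      (simp only: algebra_simps)
qed

text \<open>The rows of the Hessian of a ridge function, and its differential, are combinations of covectors
  of these three kinds.\<close>

lemma sharp_total:
  assumes "y \<in> W" "\<And>w. \<omega> w = a \<bullet> fst w + c * E e (fst w) + d * k y g (snd w)"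
  shows "sharp (G (x, y)) \<omega> =
    ((\<phi> (\<alpha> \<bullet> x))\<^sup>2 *\<^sub>R (J a + c *\<^sub>R e), (d / (f (\<alpha> \<bullet> x))\<^sup>2) *\<^sub>R g)"
  by (rule sharp_eqI[OF total.bil total.nondeg])
    (use assms in \<open>auto simp: G J_simps J_J inner_add_left bilinear_lmul[OF bil]\<close>)

lemma total_laplacian:
  fixes x :: 'a
  assumes H\<xi>: "\<forall>x. \<forall>y\<in>W. H\<xi> (x, y) = H (\<alpha> \<bullet> x)"
    and H': "\<And>t. (H has_real_derivative H' t) (at t)"
    and H'': "\<And>t. (H' has_real_derivative H'' t) (at t)" and y: "y \<in> W"
  defines "t \<equiv> \<alpha> \<bullet> x" and "n \<equiv> real DIM('a)" and "m \<equiv> real DIM('b)"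
  shows "laplacian G H\<xi> (x, y) =
    (H'' t - (n - 2) * (\<phi>' t / \<phi> t) * H' t + m * H' t * (f' t / f t)) * N * (\<phi> t)\<^sup>2"
proof -
  define A where "A = H'' t + 2 * (\<phi>' t / \<phi> t) * H' t"
  define B where "B = - (\<phi>' t / \<phi> t) * H' t * N"
  define C where "C = (f' t / f t) * H' t * N * (\<phi> t)\<^sup>2"
  have hess: "hess G H\<xi> (x, y) e w = (A * (\<alpha> \<bullet> fst e)) *\<^sub>R \<alpha> \<bullet> fst w + B * E (fst e) (fst w)
      + (C * (f t)\<^sup>2) * k y (snd e) (snd w)" for e w
    using total_hess[where H\<xi>=H\<xi>, OF H\<xi> H' H'' y, of x e w]
    by (simp add: A_def B_def C_def t_def algebra_simps)
  have sharp: "sharp (G (x, y)) (hess G H\<xi> (x, y) e) \<bullet> e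
      = (\<phi> t)\<^sup>2 * A * ((\<alpha> \<bullet> fst e) * (J \<alpha> \<bullet> fst e)) + (\<phi> t)\<^sup>2 * B * (fst e \<bullet> fst e)
        + C * (snd e \<bullet> snd e)" for e
    by (subst sharp_total[OF y hess])
      (simp add: t_def inner_prod_def J_simps inner_add_left algebra_simps)
  have "laplacian G H\<xi> (x, y) = (\<phi> t)\<^sup>2 * A * N + (\<phi> t)\<^sup>2 * B * n + C * m"
    unfolding laplacian_def metric_trace_def sum_Basis_prod sharp fst_conv snd_conv
    by (simp only: inner_zero_right inner_zero_left mult_zero_right add_0_right add_0_left
        sum.distrib sum_distrib_left[symmetric] sum_Basis_inner sum_Basis_inner_same)
      (simp add: n_def m_def inner_commute)
  then show ?thesis unfolding A_def B_def C_def by (simp add: algebra_simps diff_divide_distrib)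
qed

lemma total_grad:
  assumes "\<forall>x. \<forall>y\<in>W. H\<xi> (x, y) = H (\<alpha> \<bullet> x)"
    and "\<And>t. (H has_real_derivative H' t) (at t)" and "y \<in> W"
  shows "grad G H\<xi> (x, y) = (((\<phi> (\<alpha> \<bullet> x))\<^sup>2 * H' (\<alpha> \<bullet> x)) *\<^sub>R J \<alpha>, 0)"
  unfolding grad_def
  by (subst sharp_total[OF assms(3), where a="H' (\<alpha> \<bullet> x) *\<^sub>R \<alpha>" and c=0 and d=0 and e=0 and g=0])
    (simp_all add: ridge_dir_deriv[where H\<xi>=H\<xi>, OF assms] J_simps)

lemma total_grad_inner:
  assumes "\<forall>x. \<forall>y\<in>W. H\<xi> (x, y) = H (\<alpha> \<bullet> x)"
    and "\<And>t. (H has_real_derivative H' t) (at t)"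
    and "\<forall>x. \<forall>y\<in>W. U\<xi> (x, y) = U (\<alpha> \<bullet> x)"
    and "\<And>t. (U has_real_derivative U' t) (at t)" and "y \<in> W"
  shows "G (x, y) (grad G U\<xi> (x, y)) (grad G H\<xi> (x, y))
    = U' (\<alpha> \<bullet> x) * H' (\<alpha> \<bullet> x) * N * (\<phi> (\<alpha> \<bullet> x))\<^sup>2"
  using assms(5)
  by (simp add: total_grad[where H\<xi>=H\<xi>, OF assms(1,2,5)] total_grad[where H\<xi>=U\<xi>, OF assms(3,4,5)]
      G J_simps J_J bilinear_lzero[OF bil] inner_commute power2_eq_square)

end

section \<open>The soliton equations\<close>

text \<open>The form \<open>(\<alpha> \<bullet> v)(\<alpha> \<bullet> w)\<close> has rank one, hence is no multiple of a nondegenerate form in dimension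
  at least two.\<close>

lemma rank_one_plus_nondegenerate_zero:
  fixes \<alpha> :: "'a::euclidean_space"
  assumes "2 \<le> DIM('a)" "\<alpha> \<noteq> 0" and J: "linear J" "\<And>v. J (J v) = v"
    and zero: "\<And>v w. a * ((\<alpha> \<bullet> v) * (\<alpha> \<bullet> w)) + b * (J v \<bullet> w) = 0"
  shows "a = 0" "b = 0"
proof -
  obtain v where v: "v \<noteq> 0" "orthogonal \<alpha> v" using orthogonal_to_vector_exists[OF assms(1)] by blast
  have "J v \<noteq> 0" using v(1) J(2)[of v] linear_0[OF J(1)] by auto
  then show "b = 0" using zero[of v "J v"] v(2) by (simp add: orthogonal_def)
  then show "a = 0" using zero[of \<alpha> \<alpha>] assms(2) by simp
qed

text \<open>
  The soliton equations in one product chart, separated into equations along the base and an Einstein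
  condition on the fibre. Both sides are vacuous when \<open>W\<close> is empty, hence the bounded quantifier
  over \<open>W\<close> in front of the equations on \<open>t\<close>.
\<close>

lemma (in warped_metric) soliton_iff:
  fixes \<theta> lam :: real and H H' H'' U U' U'' :: "real \<Rightarrow> real"
  assumes dim: "2 \<le> DIM('a)" and \<alpha>: "\<alpha> \<noteq> 0"
    and H: "\<forall>x. \<forall>y\<in>W. H\<xi> (x, y) = H (\<alpha> \<bullet> x)"
      "\<And>t. (H has_real_derivative H' t) (at t)" "\<And>t. (H' has_real_derivative H'' t) (at t)"
    and U: "\<forall>x. \<forall>y\<in>W. U\<xi> (x, y) = U (\<alpha> \<bullet> x)"
      "\<And>t. (U has_real_derivative U' t) (at t)" "\<And>t. (U' has_real_derivative U'' t) (at t)"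
  defines "n \<equiv> real DIM('a)" and "m \<equiv> real DIM('b)"
  shows "(\<forall>z\<in>UNIV \<times> W.
      (\<forall>v w. ricci G z v w + hess G H\<xi> z v w - \<theta> * (dir_deriv U\<xi> v z * dir_deriv U\<xi> w z)
        = lam * G z v w) \<and>
      laplacian G U\<xi> z - G z (grad G U\<xi> z) (grad G H\<xi> z) = 0)
    \<longleftrightarrow> (\<forall>y\<in>W. \<forall>t.
      (n - 2) * (\<phi>'' t / \<phi> t) - m * (f'' t / f t) - 2 * m * (\<phi>' t / \<phi> t) * (f' t / f t) + H'' t
        + 2 * (\<phi>' t / \<phi> t) * H' t - \<theta> * (U' t)\<^sup>2 = 0 \<and>
      (\<phi>'' t / \<phi> t - (n - 1) * (\<phi>' t / \<phi> t)\<^sup>2 + m * (\<phi>' t / \<phi> t) * (f' t / f t)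
        - (\<phi>' t / \<phi> t) * H' t) * N = lam / (\<phi> t)\<^sup>2 \<and>
      (\<forall>v w. ricci k y v w =
        ((f'' t / f t - (n - 2) * (\<phi>' t / \<phi> t) * (f' t / f t) + (m - 1) * (f' t / f t)\<^sup>2
          - (f' t / f t) * H' t) * N + lam / (\<phi> t)\<^sup>2) * ((f t)\<^sup>2 * (\<phi> t)\<^sup>2) * k y v w) \<and>
      (U'' t - (n - 2) * (\<phi>' t / \<phi> t) * U' t + m * U' t * (f' t / f t) - U' t * H' t) * N = 0)"
proof -
  define A where "A t = (n - 2) * (\<phi>'' t / \<phi> t) - m * (f'' t / f t)
    - 2 * m * (\<phi>' t / \<phi> t) * (f' t / f t) + H'' t + 2 * (\<phi>' t / \<phi> t) * H' t - \<theta> * (U' t)\<^sup>2" for t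
  define B where "B t = (\<phi>'' t / \<phi> t - (n - 1) * (\<phi>' t / \<phi> t)\<^sup>2 + m * (\<phi>' t / \<phi> t) * (f' t / f t)
    - (\<phi>' t / \<phi> t) * H' t) * N" for t
  define M where "M t = ((f'' t / f t - (n - 2) * (\<phi>' t / \<phi> t) * (f' t / f t)
    + (m - 1) * (f' t / f t)\<^sup>2 - (f' t / f t) * H' t) * N + lam / (\<phi> t)\<^sup>2)
      * ((f t)\<^sup>2 * (\<phi> t)\<^sup>2)" for t
  define D where "D t = (U'' t - (n - 2) * (\<phi>' t / \<phi> t) * U' t + m * U' t * (f' t / f t)
    - U' t * H' t) * N" for t
  have soliton: "ricci G (x, y) v w + hess G H\<xi> (x, y) v w
      - \<theta> * (dir_deriv U\<xi> v (x, y) * dir_deriv U\<xi> w (x, y)) - lam * G (x, y) v w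
    = A (\<alpha> \<bullet> x) * ((\<alpha> \<bullet> fst v) * (\<alpha> \<bullet> fst w)) + (B (\<alpha> \<bullet> x) - lam / (\<phi> (\<alpha> \<bullet> x))\<^sup>2) * E (fst v) (fst w)
      + (ricci k y (snd v) (snd w) - M (\<alpha> \<bullet> x) * k y (snd v) (snd w))" if "y \<in> W" for x y v w
  proof -
    define t where "t = \<alpha> \<bullet> x"
    have [simp]: "lam / (\<phi> t)\<^sup>2 * ((f t)\<^sup>2 * (\<phi> t)\<^sup>2) = lam * (f t)\<^sup>2" by simp
    show ?thesis
      unfolding total_ricci[OF that] total_hess[where H\<xi>=H\<xi>, OF H that]
        ridge_dir_deriv[where H\<xi>=U\<xi>, OF U(1,2) that] G[OF that] A_def B_def M_def
        t_def[symmetric] n_def[symmetric] m_def[symmetric]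
        distrib_right[of _ "lam / (\<phi> t)\<^sup>2" "(f t)\<^sup>2 * (\<phi> t)\<^sup>2"]
      by (simp add: diff_divide_distrib algebra_simps power2_eq_square)
  qed
  have harmonic: "laplacian G U\<xi> (x, y) - G (x, y) (grad G U\<xi> (x, y)) (grad G H\<xi> (x, y))
      = D (\<alpha> \<bullet> x) * (\<phi> (\<alpha> \<bullet> x))\<^sup>2" if "y \<in> W" for x y
    unfolding total_laplacian[where H\<xi>=U\<xi>, OF U that]
      total_grad_inner[where H\<xi>=H\<xi> and U\<xi>=U\<xi>, OF H(1,2) U(1,2) that] D_def
    by (simp add: n_def m_def algebra_simps)
  have ex: "\<exists>x. \<alpha> \<bullet> x = t" for t using \<alpha> by (intro exI[of _ "(t / (\<alpha> \<bullet> \<alpha>)) *\<^sub>R \<alpha>"]) simp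
  have point: "(\<forall>v w. ricci G (x, y) v w + hess G H\<xi> (x, y) v w
        - \<theta> * (dir_deriv U\<xi> v (x, y) * dir_deriv U\<xi> w (x, y)) = lam * G (x, y) v w)
    \<longleftrightarrow> A (\<alpha> \<bullet> x) = 0 \<and> B (\<alpha> \<bullet> x) = lam / (\<phi> (\<alpha> \<bullet> x))\<^sup>2 \<and>
      (\<forall>v w. ricci k y v w = M (\<alpha> \<bullet> x) * k y v w)" (is "?L \<longleftrightarrow> ?R") if y: "y \<in> W" for x y
  proof
    assume L: ?L
    have *: "A (\<alpha> \<bullet> x) * ((\<alpha> \<bullet> fst v) * (\<alpha> \<bullet> fst w))
      + (B (\<alpha> \<bullet> x) - lam / (\<phi> (\<alpha> \<bullet> x))\<^sup>2) * E (fst v) (fst w)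
      + (ricci k y (snd v) (snd w) - M (\<alpha> \<bullet> x) * k y (snd v) (snd w)) = 0" for v w
      using soliton[OF y, of x v w] L[THEN spec, THEN spec, of v w] by simp
    have R: "ricci k y v w = M (\<alpha> \<bullet> x) * k y v w" for v w
      using *[of "(0, v)" "(0, w)"] by (simp add: linear_0[OF linJ])
    have "A (\<alpha> \<bullet> x) * ((\<alpha> \<bullet> v) * (\<alpha> \<bullet> w)) + (B (\<alpha> \<bullet> x) - lam / (\<phi> (\<alpha> \<bullet> x))\<^sup>2) * (J v \<bullet> w) = 0" for v w
      using *[of "(v, 0)" "(w, 0)"] R by simp
    from rank_one_plus_nondegenerate_zero[OF dim \<alpha> linJ J_J this] R show ?R by simp
  next
    assume R: ?R
    show ?L
    proof (intro allI)
      fix v w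
      show "ricci G (x, y) v w + hess G H\<xi> (x, y) v w
        - \<theta> * (dir_deriv U\<xi> v (x, y) * dir_deriv U\<xi> w (x, y)) = lam * G (x, y) v w"
        using soliton[OF y, of x v w] R by simp
    qed
  qed
  show ?thesis
    unfolding A_def[symmetric] B_def[symmetric] M_def[symmetric] D_def[symmetric]
  proof (intro iffI ballI allI)
    fix y t assume L: "\<forall>z\<in>UNIV \<times> W.
      (\<forall>v w. ricci G z v w + hess G H\<xi> z v w - \<theta> * (dir_deriv U\<xi> v z * dir_deriv U\<xi> w z)
        = lam * G z v w) \<and>
      laplacian G U\<xi> z - G z (grad G U\<xi> z) (grad G H\<xi> z) = 0" and y: "y \<in> W"
    obtain x where x: "\<alpha> \<bullet> x = t" using ex by blast
    have "(x, y) \<in> UNIV \<times> W" using y by simp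
    from bspec[OF L this] point[OF y, of x] harmonic[OF y, of x]
    show "A t = 0 \<and> B t = lam / (\<phi> t)\<^sup>2 \<and> (\<forall>v w. ricci k y v w = M t * k y v w) \<and> D t = 0"
      by (simp add: x)
  next
    fix z :: "'a \<times> 'b"
    assume R: "\<forall>y\<in>W. \<forall>t. A t = 0 \<and> B t = lam / (\<phi> t)\<^sup>2 \<and>
      (\<forall>v w. ricci k y v w = M t * k y v w) \<and> D t = 0" and "z \<in> UNIV \<times> W"
    then obtain x y where z: "z = (x, y)" "y \<in> W" by blast
    have "A (\<alpha> \<bullet> x) = 0 \<and> B (\<alpha> \<bullet> x) = lam / (\<phi> (\<alpha> \<bullet> x))\<^sup>2 \<and>
      (\<forall>v w. ricci k y v w = M (\<alpha> \<bullet> x) * k y v w)" "D (\<alpha> \<bullet> x) = 0" using R z(2) by auto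
    then show "(\<forall>v w. ricci G z v w + hess G H\<xi> z v w - \<theta> * (dir_deriv U\<xi> v z * dir_deriv U\<xi> w z)
        = lam * G z v w) \<and> laplacian G U\<xi> z - G z (grad G U\<xi> z) (grad G H\<xi> z) = 0"
      unfolding z(1) point[OF z(2)] harmonic[OF z(2)] by simp
  qed
qed

section \<open>The product manifold and the components of the warped product metric\<close>

text \<open>The involution \<open>J\<close> with \<open>g\<^sub>0(v, w) = J v \<bullet> w\<close> for the semi-Euclidean metric \<open>g\<^sub>0\<close> with signs \<open>\<epsilon>\<close>.\<close>

definition sign_change :: "('n::finite \<Rightarrow> real) \<Rightarrow> real ^ 'n \<Rightarrow> real ^ 'n"
  where "sign_change \<epsilon> v = (\<chi> i. \<epsilon> i * v $ i)"

lemma sign_change_inner: "sign_change \<epsilon> v \<bullet> w = (\<Sum>i\<in>UNIV. \<epsilon> i * v $ i * w $ i)"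
  by (simp add: sign_change_def inner_vec_def)

lemma homeomorphism_inv_into_inj:
  "homeomorphism V (d ` V) d (inv_into V d) \<Longrightarrow> inj_on d V"
  by (rule inj_on_inverseI[of _ "inv_into V d"]) (rule homeomorphism_apply1)

lemma image_prod_chart: "map_prod id d ` (UNIV \<times> V) = UNIV \<times> d ` V"
proof (intro equalityI subsetI)
  fix z assume "z \<in> UNIV \<times> d ` V"
  then obtain x v where "z = (x, d v)" "v \<in> V" by blast
  then show "z \<in> map_prod id d ` (UNIV \<times> V)" by (intro image_eqI[of _ _ "(x, v)"]) auto
qed auto

lemma inv_into_prod_chart:
  assumes "inj_on d V" "y \<in> d ` V"
  shows "inv_into (UNIV \<times> V) (map_prod id d) (x, y) = (x, inv_into V d y)"
proof (rule inv_into_f_eq)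
  show "inj_on (map_prod id d) (UNIV \<times> V)" using assms(1) by (intro map_prod_inj_on) auto
qed (use assms in \<open>auto simp: inv_into_into f_inv_into_f\<close>)

lemma prod_euclidean_atlas:
  fixes A :: "('q, 'b::euclidean_space) chart set"
  shows "prod_atlas (euclidean_atlas :: ('a, 'a::euclidean_space) chart set) A = (\<lambda>(V, d). (UNIV \<times> V, map_prod id d)) ` A"
proof (intro set_eqI iffI)
  fix z :: "('a \<times> 'q) set \<times> ('a \<times> 'q \<Rightarrow> 'a \<times> 'b)"
  assume "z \<in> prod_atlas euclidean_atlas A"
  then obtain V d where z: "z = (UNIV \<times> V, map_prod id d)" "(V, d) \<in> A"
    unfolding prod_atlas_def euclidean_atlas_def by blast
  show "z \<in> (\<lambda>(V, d). (UNIV \<times> V, map_prod id d)) ` A"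
    by (rule image_eqI[OF _ z(2)]) (simp add: z(1))
next
  fix z :: "('a \<times> 'q) set \<times> ('a \<times> 'q \<Rightarrow> 'a \<times> 'b)"
  assume "z \<in> (\<lambda>(V, d). (UNIV \<times> V, map_prod id d)) ` A"
  then obtain V d where z: "z = (UNIV \<times> V, map_prod id d)" "(V, d) \<in> A" by auto
  then show "z \<in> prod_atlas euclidean_atlas A"
    unfolding prod_atlas_def euclidean_atlas_def by blast
qed

lemma ball_prod_atlas:
  fixes A :: "('q, 'b::euclidean_space) chart set"
  shows "(\<forall>(U, c)\<in>prod_atlas (euclidean_atlas :: ('a, 'a::euclidean_space) chart set) A. P U c)
    \<longleftrightarrow> (\<forall>(V, d)\<in>A. P (UNIV \<times> V) (map_prod id d))"
  unfolding prod_euclidean_atlas by force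

lemma differentiable_snd_iff:
  "(\<lambda>z. K (snd z)) differentiable (at (x, y)) \<longleftrightarrow> K differentiable (at y)"
proof
  assume "(\<lambda>z. K (snd z)) differentiable (at (x, y))"
  then obtain D where D: "((\<lambda>z. K (snd z)) has_derivative D) (at (x, y))"
    by (auto simp: differentiable_def)
  have "((\<lambda>y. (x, y)) has_derivative (\<lambda>v. (0, v))) (at y)"
    by (auto intro!: derivative_eq_intros)
  from has_derivative_compose[OF this D] show "K differentiable (at y)"
    by (auto simp: differentiable_def)
next
  assume "K differentiable (at y)"
  from has_derivative_compose[of snd snd "(x, y)" UNIV, OF _ has_dir_deriv, of K] this
  show "(\<lambda>z. K (snd z)) differentiable (at (x, y))"
    by (auto simp: differentiable_def bounded_linear_imp_has_derivative bounded_linear_snd)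
qed

lemma dir_deriv_snd:
  assumes "K differentiable (at y)"
  shows "dir_deriv (\<lambda>z. K (snd z)) v (x, y) = dir_deriv K (snd v) y"
  using has_derivative_compose[of snd snd "(x, y)" UNIV K "\<lambda>v. dir_deriv K v y"] has_dir_deriv[OF assms]
  by (auto intro!: dir_deriv_eq simp: bounded_linear_imp_has_derivative bounded_linear_snd)

lemma continuous_on_map_prod_id:
  "continuous_on V d \<Longrightarrow> continuous_on (UNIV \<times> V) (map_prod id d)"
  unfolding map_prod_def case_prod_unfold
  by (auto intro!: continuous_intros continuous_on_compose2[of V d])

text \<open>
  From here on \<open>(V, d)\<close> is a chart of the fibre. A function on the product that is differentiated by a
  coordinate vector only matters near the point, where its coordinate expression is \<open>L\<close>.
\<close>

context
  fixes V :: "'q::{t2_space,second_countable_topology} set" and d :: "'q \<Rightarrow> 'b::euclidean_space"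
  assumes inj: "inj_on d V" and open_image: "open (d ` V)"
begin

lemma coord_vector_prod:
  fixes x :: "'a::euclidean_space" and F :: "'a \<times> 'q \<Rightarrow> real"
  assumes "y \<in> d ` V" and "\<And>x y. y \<in> d ` V \<Longrightarrow> F (x, inv_into V d y) = L (x, y)"
  shows "coord_vector (UNIV \<times> V, map_prod id d) (x, inv_into V d y) v F
    = (if L differentiable (at (x, y)) then dir_deriv L v (x, y) else 0)"
proof -
  have S: "open ((UNIV :: 'a set) \<times> d ` V)" "(x, y) \<in> UNIV \<times> d ` V"
    using open_image assms(1) by (auto intro: open_Times)
  have "(F \<circ> inv_into (UNIV \<times> V) (map_prod id d)) z = L z" if "z \<in> UNIV \<times> d ` V" for z
    using that assms(2) by (cases z) (simp add: inv_into_prod_chart[OF inj])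
  note * = differentiable_transform_open[where g=L, OF S this] dir_deriv_transform[where g=L, OF S this]
  have "map_prod id d (x, inv_into V d y) = (x, y)" using assms(1) by (simp add: f_inv_into_f)
  then show ?thesis
    unfolding coord_vector_def split_conv by (simp only: *)
qed

text \<open>Here the derivations agree on all functions, including those sent to 0 because they are not
  differentiable, so that the fibre metric sees exactly a coordinate vector of the fibre.\<close>

lemma push_forward_snd_coord_vector:
  assumes "y \<in> d ` V"
  shows "push_forward snd (coord_vector (UNIV \<times> V, map_prod id d) (x :: 'a::euclidean_space, inv_into V d y) v)
    = coord_vector (V, d) (inv_into V d y) (snd v)"
proof
  fix F :: "'q \<Rightarrow> real"
  define K where "K = F \<circ> inv_into V d"
  have "coord_vector (UNIV \<times> V, map_prod id d) (x, inv_into V d y) v (F \<circ> snd)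
    = (if (\<lambda>z. K (snd z)) differentiable (at (x, y)) then dir_deriv (\<lambda>z. K (snd z)) v (x, y) else 0)"
    by (rule coord_vector_prod[OF assms]) (simp add: K_def)
  also have "\<dots> = (if K differentiable (at y) then dir_deriv K (snd v) y else 0)"
    by (simp add: differentiable_snd_iff dir_deriv_snd)
  also have "\<dots> = coord_vector (V, d) (inv_into V d y) (snd v) F"
    using assms by (simp add: coord_vector_def f_inv_into_f K_def)
  finally show "push_forward snd (coord_vector (UNIV \<times> V, map_prod id d) (x, inv_into V d y) v) F
    = coord_vector (V, d) (inv_into V d y) (snd v) F"
    unfolding push_forward_def .
qed

lemma push_forward_fst_coord_vector:
  assumes "y \<in> d ` V"
  shows "push_forward fst (coord_vector (UNIV \<times> V, map_prod id d) (x, inv_into V d y) v) (\<lambda>x. x $ i)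
    = fst v $ i"
proof -
  have D: "((\<lambda>z. fst z $ i) has_derivative (\<lambda>v. fst v $ i)) (at (x, y))"
    by (auto intro!: derivative_eq_intros bounded_linear_imp_has_derivative
        bounded_linear_compose[OF bounded_linear_vec_nth] bounded_linear_fst)
  show ?thesis
    unfolding push_forward_def
    using coord_vector_prod[OF assms, of "(\<lambda>x. x $ i) \<circ> fst" "\<lambda>z. fst z $ i" x v] D dir_deriv_eq[OF D]
    by (auto simp: differentiable_def)
qed

lemma components_warped_product:
  assumes "y \<in> d ` V"
  shows "components (warped_product (scale_metric r (semi_euclidean \<epsilon>)) f gF)
      (UNIV \<times> V, map_prod id d) (x, y) v w
    = r x * (sign_change \<epsilon> (fst v) \<bullet> fst w)
      + (f x)\<^sup>2 * components gF (V, d) y (snd v) (snd w)"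
  using assms
  by (simp add: components_def Let_def inv_into_prod_chart[OF inj] warped_product_def scale_metric_def
      semi_euclidean_def sign_change_inner push_forward_fst_coord_vector
      push_forward_snd_coord_vector)

end

lemma smooth_atlasD:
  assumes "smooth_atlas A" "(V, d) \<in> A"
  shows "open V" "open (d ` V)" "homeomorphism V (d ` V) d (inv_into V d)" "inj_on d V"
proof -
  have *: "\<forall>(U, c)\<in>A. open U \<and> open (c ` U) \<and> homeomorphism U (c ` U) c (inv_into U c)"
    using assms(1) unfolding smooth_atlas_def by (elim conjE)
  show "open V" "open (d ` V)" "homeomorphism V (d ` V) d (inv_into V d)"
    using bspec[OF * assms(2)] by simp_all
  then show "inj_on d V" by (simp add: homeomorphism_inv_into_inj)
qed

lemma smooth_atlas_transition:
  assumes "smooth_atlas A" "(V, d) \<in> A" "(V', d') \<in> A"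
  shows "smooth_on (d' \<circ> inv_into V d) (d ` (V \<inter> V'))"
proof -
  have "\<forall>(U, c)\<in>A. \<forall>(V, d)\<in>A. smooth_on (d \<circ> inv_into U c) (c ` (U \<inter> V))"
    using assms(1) unfolding smooth_atlas_def by (elim conjE)
  then show ?thesis using assms(2,3) by blast
qed

lemma smooth_atlas_nonempty: "smooth_atlas A \<Longrightarrow> \<exists>V d. (V, d) \<in> A \<and> V \<noteq> {}"
  unfolding smooth_atlas_def by (elim conjE) auto

lemma smooth_atlas_prod:
  fixes A :: "('q::{t2_space,second_countable_topology}, 'b::euclidean_space) chart set"
  assumes A: "smooth_atlas A"
  shows "smooth_atlas (prod_atlas (euclidean_atlas :: ('a, 'a::euclidean_space) chart set) A)"
proof -
  note chart = smooth_atlasD[OF A] and trans = smooth_atlas_transition[OF A]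
    and nonempty = smooth_atlas_nonempty[OF A]
  have homeo: "homeomorphism ((UNIV :: 'a set) \<times> V) (UNIV \<times> d ` V) (map_prod id d)
      (inv_into (UNIV \<times> V) (map_prod id d))" if "(V, d) \<in> A" for V d
  proof -
    note h = chart(3)[OF that, unfolded homeomorphism_def]
    have "homeomorphism ((UNIV :: 'a set) \<times> V) (UNIV \<times> d ` V) (map_prod id d)
      (map_prod id (inv_into V d))"
      unfolding homeomorphism_def
      using h image_prod_chart[of "inv_into V d" "d ` V"] image_prod_chart[of d V]
      by (simp add: continuous_on_map_prod_id)
    then show ?thesis
      by (rule homeomorphism_cong) (auto simp: inv_into_prod_chart[OF chart(4)[OF that]])
  qed
  have smooth: "smooth_on (map_prod id d' \<circ> inv_into (UNIV \<times> V) (map_prod id d))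
      (map_prod id d ` ((UNIV :: 'a set) \<times> V \<inter> UNIV \<times> V'))" if VV: "(V, d) \<in> A" "(V', d') \<in> A" for V d V' d'
  proof -
    have op: "open (d ` (V \<inter> V'))"
      using homeomorphism_imp_open_map[OF chart(3)[OF VV(1)], of "V \<inter> V'"]
        chart(1)[OF VV(1)] chart(1)[OF VV(2)] chart(2)[OF VV(1)]
      by (simp add: openin_open_eq open_Int)
    let ?S = "(UNIV :: 'a set) \<times> d ` (V \<inter> V')"
    have S: "open ?S" using op by (simp add: open_Times)
    have "Ck_on k (\<lambda>z. (d' \<circ> inv_into V d) (snd z)) ?S" for k
      by (rule Ck_on_compose_linear[OF S bounded_linear_snd _
            trans[OF VV, unfolded smooth_on_def, rule_format]]) auto
    then have "Ck_on k (\<lambda>z. (fst z, (d' \<circ> inv_into V d) (snd z))) ?S" for k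
      by (intro Ck_on_Pair[OF S Ck_on_linear[OF S bounded_linear_fst]])
    then have "smooth_on (\<lambda>z. (fst z, (d' \<circ> inv_into V d) (snd z))) ?S"
      by (simp add: smooth_on_def)
    then have "smooth_on (map_prod id d' \<circ> inv_into (UNIV \<times> V) (map_prod id d)) ?S"
      by (subst smooth_on_cong[OF S])
        (auto simp: inv_into_prod_chart[OF chart(4)[OF VV(1)]])
    moreover have "((UNIV :: 'a set) \<times> V \<inter> UNIV \<times> V') = UNIV \<times> (V \<inter> V')" by auto
    ultimately show ?thesis by (simp only: image_prod_chart)
  qed
  show ?thesis
    unfolding smooth_atlas_def prod_euclidean_atlas
  proof (intro conjI ballI)
    show "\<exists>(U, c)\<in>(\<lambda>(V, d). ((UNIV :: 'a set) \<times> V, map_prod id d)) ` A. U \<noteq> {}"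
      using nonempty by force
  next
    fix z :: "('a \<times> 'q, 'a \<times> 'b) chart"
    assume "z \<in> (\<lambda>(V, d). ((UNIV :: 'a set) \<times> V, map_prod id d)) ` A"
    then obtain V d where z: "z = (UNIV \<times> V, map_prod id d)" "(V, d) \<in> A" by auto
    show "case z of (U, c) \<Rightarrow> open U \<and> open (c ` U) \<and> homeomorphism U (c ` U) c (inv_into U c)"
      unfolding z split_conv image_prod_chart
      by (intro conjI open_Times open_UNIV chart(1,2)[OF z(2)] homeo[OF z(2)])
    show "case z of (U, c) \<Rightarrow> \<forall>(V, d)\<in>(\<lambda>(V, d). ((UNIV :: 'a set) \<times> V, map_prod id d)) ` A.
        smooth_on (d \<circ> inv_into U c) (c ` (U \<inter> V))"
      unfolding z split_conv
    proof (intro ballI)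
      fix z' :: "('a \<times> 'q, 'a \<times> 'b) chart"
      assume "z' \<in> (\<lambda>(V, d). ((UNIV :: 'a set) \<times> V, map_prod id d)) ` A"
      then obtain V' d' where z': "z' = (UNIV \<times> V', map_prod id d')" "(V', d') \<in> A" by auto
      show "case z' of (V', d') \<Rightarrow> smooth_on (d' \<circ> inv_into (UNIV \<times> V) (map_prod id d))
          (map_prod id d ` (UNIV \<times> V \<inter> V'))"
        unfolding z'(1) split_conv by (rule smooth[OF z(2) z'(2)])
    qed
  qed
qed

text \<open>An orthonormal basis consists of the rescaled orthonormal bases of the two factors; \<open>e\<close> and \<open>s\<close> are
  indexed by the standard basis of the product.\<close>

lemma has_index_warped:
  fixes \<epsilon> :: "'n::finite \<Rightarrow> real" and k :: "'b::euclidean_space \<Rightarrow> 'b \<Rightarrow> real"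
  assumes eps: "\<And>i. \<epsilon> i = 1 \<or> \<epsilon> i = - 1" and k: "bilinear k" "has_index k q" and pos: "a > 0" "r > 0"
  shows "has_index (\<lambda>v w. 1 / a\<^sup>2 * (sign_change \<epsilon> (fst v) \<bullet> fst w) + r\<^sup>2 * k (snd v) (snd w))
    (card {i. \<epsilon> i = - 1} + q)"
proof -
  obtain eF :: "'b \<Rightarrow> 'b" and sF :: "'b \<Rightarrow> real" where F: "\<forall>i\<in>Basis. sF i = 1 \<or> sF i = - 1"
      "\<forall>i\<in>Basis. \<forall>j\<in>Basis. k (eF i) (eF j) = (if i = j then sF i else 0)"
      "card {i \<in> Basis. sF i = - 1} = q"
    using k(2) unfolding has_index_def by auto
  define e :: "(real ^ 'n) \<times> 'b \<Rightarrow> (real ^ 'n) \<times> 'b"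
    where "e b = (if snd b = 0 then (a *\<^sub>R fst b, 0) else (0, (1 / r) *\<^sub>R eF (snd b)))" for b
  define s :: "(real ^ 'n) \<times> 'b \<Rightarrow> real"
    where "s b = (if snd b = 0 then sign_change \<epsilon> (fst b) \<bullet> fst b else sF (snd b))" for b
  let ?g = "\<lambda>v w. 1 / a\<^sup>2 * (sign_change \<epsilon> (fst v) \<bullet> fst w) + r\<^sup>2 * k (snd v) (snd w)"
  let ?b = "\<lambda>i :: 'n. (axis i (1 :: real), 0 :: 'b)"
  have ax: "sign_change \<epsilon> (axis i 1) \<bullet> axis j 1 = (if i = j then \<epsilon> i else 0)" for i j
    by (simp add: inner_axis sign_change_def) (simp add: axis_def)
  have sc: "sign_change \<epsilon> 0 = 0" "sign_change \<epsilon> (a *\<^sub>R v) = a *\<^sub>R sign_change \<epsilon> v" for v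
    by (simp_all add: sign_change_def vec_eq_iff)
  have Basis: "(Basis :: ((real ^ 'n) \<times> 'b) set) = range ?b \<union> Pair 0 ` Basis"
    by (auto simp: Basis_prod_def Basis_vec_def)
  have s1: "s (?b i) = \<epsilon> i" and e1: "e (?b i) = (a *\<^sub>R axis i 1, 0)" for i
    by (simp_all add: s_def e_def ax)
  have s2: "s (0, b) = sF b" and e2: "e (0, b) = (0, (1 / r) *\<^sub>R eF b)" if "b \<in> Basis" for b
    using that by (auto simp: s_def e_def)
  have "{b \<in> Basis. s b = - 1} = ?b ` {i. \<epsilon> i = - 1} \<union> Pair 0 ` {b \<in> Basis. sF b = - 1}"
    unfolding Basis using s1 s2 by auto
  moreover have "card (?b ` {i. \<epsilon> i = - 1}) = card {i. \<epsilon> i = - 1}"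
    by (rule card_image) (simp add: inj_on_def axis_eq_axis)
  moreover have "card (Pair (0 :: real ^ 'n) ` {b \<in> Basis. sF b = - 1}) = q"
    using F(3) by (subst card_image) (simp_all add: inj_on_def)
  moreover have "?b ` {i. \<epsilon> i = - 1} \<inter> Pair 0 ` {b \<in> Basis. sF b = - 1} = {}"
    by auto
  ultimately have "card {b \<in> Basis. s b = - 1} = card {i. \<epsilon> i = - 1} + q"
    by (simp add: card_Un_disjoint)
  moreover have "\<forall>b\<in>Basis. s b = 1 \<or> s b = - 1"
    unfolding Basis using F(1) eps by (simp add: ball_Un s1 s2)
  moreover have "?g (e b) (e c) = (if b = c then s b else 0)" if "b \<in> Basis" "c \<in> Basis" for b c
  proof -
    note [simp] = s1 s2 e1 e2 ax sc bilinear_lmul[OF k(1)] bilinear_rmul[OF k(1)]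
      bilinear_lzero[OF k(1)] bilinear_rzero[OF k(1)] axis_eq_axis
    from that[unfolded Basis] consider
        i j where "b = ?b i" "c = ?b j"
      | i c' where "b = ?b i" "c = (0, c')" "c' \<in> Basis"
      | b' j where "b = (0, b')" "c = ?b j" "b' \<in> Basis"
      | b' c' where "b = (0, b')" "c = (0, c')" "b' \<in> Basis" "c' \<in> Basis"
      by blast
    then show ?thesis
    proof cases
      case 1
      then show ?thesis using pos by (simp add: power2_eq_square)
    next
      case 4
      then show ?thesis using pos F(2) by (simp add: power2_eq_square)
    qed auto
  qed
  ultimately show ?thesis
    unfolding has_index_def by blast
qed

section \<open>Warped products over a base metric depending on one linear coordinate\<close>

lemma semi_riemannian_smooth_components:
  "semi_riemannian A g \<Longrightarrow> (V, d) \<in> A \<Longrightarrow> smooth_on (\<lambda>x. components g (V, d) x v w) (d ` V)"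
  unfolding semi_riemannian_def by fast

lemma semi_riemannian_local_metric:
  assumes g: "semi_riemannian A g" "(V, d) \<in> A"
  shows "local_metric (d ` V) (components g (V, d))"
proof
  have "smooth_atlas A" using g(1) unfolding semi_riemannian_def by (elim conjE)
  then show "open (d ` V)" using g(2) by (rule smooth_atlasD)
  fix y v w assume y: "y \<in> d ` V"
  show "(\<lambda>y. components g (V, d) y v w) differentiable (at y)"
    by (rule smooth_on_differentiable[OF semi_riemannian_smooth_components[OF g] y])
  have "\<forall>(U, c)\<in>A. (\<forall>v w. smooth_on (\<lambda>x. components g (U, c) x v w) (c ` U)) \<and>
       (\<forall>x\<in>c ` U. bilinear (components g (U, c) x) \<and>
          (\<forall>v w. components g (U, c) x v w = components g (U, c) x w v) \<and>
          (\<forall>v. (\<forall>w. components g (U, c) x v w = 0) \<longrightarrow> v = 0))"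
    using g(1) unfolding semi_riemannian_def by (elim conjE)
  from bspec[OF this g(2)]
  have *: "bilinear (components g (V, d) y)"
      "\<forall>v w. components g (V, d) y v w = components g (V, d) y w v"
      "\<forall>v. (\<forall>w. components g (V, d) y v w = 0) \<longrightarrow> v = 0"
    using y by auto
  show "bilinear (components g (V, d) y)" by (rule *)
  show "components g (V, d) y v w = components g (V, d) y w v" using *(2) by simp
  show "v = 0" if "\<And>w. components g (V, d) y v w = 0" using *(3) that by simp
qed

text \<open>Restrict to the line spanned by \<open>\<alpha>\<close>.\<close>

lemma smooth_on_ridgeD:
  fixes F :: "real \<Rightarrow> real"
  assumes "\<alpha> \<noteq> (0 :: 'a::euclidean_space)" "smooth_on (\<lambda>x. F (\<alpha> \<bullet> x)) UNIV"
  shows "smooth_on F UNIV"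
proof -
  have "bounded_linear (\<lambda>t. (t / (\<alpha> \<bullet> \<alpha>)) *\<^sub>R \<alpha>)"
    by (intro bounded_linear_scaleR_const bounded_linear_divide)
  from smooth_on_compose_linear[OF open_UNIV this _ assms(2)]
  show ?thesis using assms(1) by simp
qed

text \<open>
  The warped product of \<open>(\<real>\<^sup>n, \<phi>(\<alpha> \<bullet> x)\<^sup>-\<^sup>2 g\<^sub>0)\<close> with the semi-Riemannian manifold \<open>(A, gF)\<close>, with warping
  function \<open>f(\<alpha> \<bullet> x)\<close>; \<open>\<phi>\<close> and \<open>f\<close> are functions of one real variable.
\<close>

locale ridge_warped_product =
  fixes \<epsilon> :: "'n::finite \<Rightarrow> real" and \<alpha> :: "real ^ 'n" and \<phi> f :: "real \<Rightarrow> real"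
    and A :: "('q::{t2_space,second_countable_topology}, real ^ 'm) chart set" and gF :: "'q metric"
  assumes eps: "\<epsilon> i = 1 \<or> \<epsilon> i = - 1"
    and smooth: "smooth_on \<phi> UNIV" "smooth_on f UNIV"
    and positive: "\<phi> t > 0" "f t > 0"
    and fibre: "semi_riemannian A gF"
begin

text \<open>The warped product metric.\<close>

definition g :: "((real ^ 'n) \<times> 'q) metric"
  where "g = warped_product (scale_metric (\<lambda>x. 1 / (\<phi> (\<alpha> \<bullet> x))\<^sup>2) (semi_euclidean \<epsilon>))
    (\<lambda>x. f (\<alpha> \<bullet> x)) gF"

lemma fibre_atlas: "smooth_atlas A"
  using fibre unfolding semi_riemannian_def by (elim conjE)

lemma components_g:
  assumes "(V, d) \<in> A" "y \<in> d ` V"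
  shows "components g (UNIV \<times> V, map_prod id d) (x, y) v w =
    (sign_change \<epsilon> (fst v) \<bullet> fst w) / (\<phi> (\<alpha> \<bullet> x))\<^sup>2
    + (f (\<alpha> \<bullet> x))\<^sup>2 * components gF (V, d) y (snd v) (snd w)"
  unfolding g_def components_warped_product[OF smooth_atlasD(4,2)[OF fibre_atlas assms(1)] assms(2)]
  by simp

lemma sign_change_involution: "sign_change \<epsilon> (sign_change \<epsilon> v) = v"
proof -
  have "\<epsilon> i * (\<epsilon> i * c) = c" for i c using eps[of i] by auto
  then show ?thesis by (simp add: sign_change_def vec_eq_iff)
qed

lemma warped_metric_chart:
  assumes "(V, d) \<in> A"
  shows "warped_metric (d ` V) (components gF (V, d)) (sign_change \<epsilon>) \<alpha>
    \<phi> (deriv \<phi>) (deriv (deriv \<phi>)) f (deriv f) (deriv (deriv f))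
    (components g (UNIV \<times> V, map_prod id d))"
proof -
  interpret local_metric "d ` V" "components gF (V, d)"
    by (rule semi_riemannian_local_metric[OF fibre assms])
  have lin: "linear (sign_change \<epsilon>)"
    by (rule linearI) (auto simp: sign_change_def vec_eq_iff algebra_simps)
  have adj: "sign_change \<epsilon> v \<bullet> w = v \<bullet> sign_change \<epsilon> w" for v w
    unfolding inner_commute[of v] sign_change_inner by (rule sum.cong) auto
  show ?thesis
    by (rule warped_metric.intro[OF local_metric_axioms], rule warped_metric_axioms.intro)
      (rule lin sign_change_involution adj smooth_on_real_deriv smooth positive components_g[OF assms]
        christoffel_differentiable[OF local_metric_axioms
          semi_riemannian_smooth_components[OF fibre assms]] | assumption)+
qed

lemma semi_riemannian_g: "semi_riemannian (prod_atlas euclidean_atlas A) g"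
proof -
  obtain q where q: "\<forall>(U, c)\<in>A. \<forall>x\<in>c ` U. has_index (components gF (U, c) x) q"
    using fibre unfolding semi_riemannian_def by (elim conjE exE)
  have chart: "smooth_on (\<lambda>z. components g (UNIV \<times> V, map_prod id d) z v w) (UNIV \<times> d ` V)"
    "z \<in> UNIV \<times> d ` V \<Longrightarrow> has_index (components g (UNIV \<times> V, map_prod id d) z) (card {i. \<epsilon> i = - 1} + q)"
    "local_metric (UNIV \<times> d ` V) (components g (UNIV \<times> V, map_prod id d))"
    if Vd: "(V, d) \<in> A" for V d v w z
  proof -
    interpret warped_metric "d ` V" "components gF (V, d)" "sign_change \<epsilon>" \<alpha>
      \<phi> "deriv \<phi>" "deriv (deriv \<phi>)" f "deriv f" "deriv (deriv f)"
      "components g (UNIV \<times> V, map_prod id d)"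
      by (rule warped_metric_chart[OF Vd])
    show "local_metric (UNIV \<times> d ` V) (components g (UNIV \<times> V, map_prod id d))"
      by (rule total.local_metric_axioms)
    have ridge: "Ck_on k (\<lambda>z. F (\<alpha> \<bullet> fst z)) (UNIV \<times> d ` V)" if "smooth_on F UNIV" for F :: "real \<Rightarrow> real" and k
      using that unfolding smooth_on_def
      by (intro Ck_on_compose_linear[OF open_S, of "\<lambda>z. \<alpha> \<bullet> fst z" UNIV k F])
        (auto intro: bounded_linear_compose[OF bounded_linear_inner_right bounded_linear_fst])
    have fib: "Ck_on k (\<lambda>z. components gF (V, d) (snd z) (snd v) (snd w)) ((UNIV :: (real ^ 'n) set) \<times> d ` V)" for k
      by (rule Ck_on_compose_linear[OF open_S bounded_linear_snd, of "d ` V"])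
        (use semi_riemannian_smooth_components[OF fibre Vd] in \<open>auto simp: smooth_on_def\<close>)
    have "Ck_on k (\<lambda>z. inverse (\<phi> (\<alpha> \<bullet> fst z)) * inverse (\<phi> (\<alpha> \<bullet> fst z)) * (sign_change \<epsilon> (fst v) \<bullet> fst w)
      + f (\<alpha> \<bullet> fst z) * f (\<alpha> \<bullet> fst z) * components gF (V, d) (snd z) (snd v) (snd w)) (UNIV \<times> d ` V)" for k
      by (intro Ck_on_add Ck_on_mult Ck_on_inverse Ck_on_const ridge fib open_S smooth) auto
    then have "smooth_on (\<lambda>z. inverse (\<phi> (\<alpha> \<bullet> fst z)) * inverse (\<phi> (\<alpha> \<bullet> fst z)) * (sign_change \<epsilon> (fst v) \<bullet> fst w)
      + f (\<alpha> \<bullet> fst z) * f (\<alpha> \<bullet> fst z) * components gF (V, d) (snd z) (snd v) (snd w)) (UNIV \<times> d ` V)"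
      by (simp add: smooth_on_def)
    then show "smooth_on (\<lambda>z. components g (UNIV \<times> V, map_prod id d) z v w) (UNIV \<times> d ` V)"
      by (subst smooth_on_cong[OF open_S])
        (auto simp: components_g[OF Vd] power2_eq_square divide_inverse)
    assume "z \<in> UNIV \<times> d ` V"
    then obtain x y where z: "z = (x, y)" "y \<in> d ` V" by blast
    have "has_index (components gF (V, d) y) q" using bspec[OF q Vd] z(2) by auto
    then have "has_index (\<lambda>v w. 1 / (\<phi> (\<alpha> \<bullet> x))\<^sup>2 * (sign_change \<epsilon> (fst v) \<bullet> fst w)
        + (f (\<alpha> \<bullet> x))\<^sup>2 * components gF (V, d) y (snd v) (snd w)) (card {i. \<epsilon> i = - 1} + q)"
      by (rule has_index_warped[OF eps bil[OF z(2)] _ positive])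
    also have "(\<lambda>v w. 1 / (\<phi> (\<alpha> \<bullet> x))\<^sup>2 * (sign_change \<epsilon> (fst v) \<bullet> fst w)
        + (f (\<alpha> \<bullet> x))\<^sup>2 * components gF (V, d) y (snd v) (snd w))
      = components g (UNIV \<times> V, map_prod id d) z"
      by (simp add: fun_eq_iff z(1) components_g[OF Vd z(2)])
    finally show "has_index (components g (UNIV \<times> V, map_prod id d) z) (card {i. \<epsilon> i = - 1} + q)" .
  qed
  show ?thesis
    unfolding semi_riemannian_def
  proof (intro conjI exI)
    show "smooth_atlas (prod_atlas (euclidean_atlas :: (real ^ 'n, real ^ 'n) chart set) A)"
      by (rule smooth_atlas_prod[OF fibre_atlas])
    show "\<forall>(U, c)\<in>prod_atlas euclidean_atlas A. \<forall>x\<in>c ` U.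
        has_index (components g (U, c) x) (card {i. \<epsilon> i = - 1} + q)"
      unfolding ball_prod_atlas image_prod_chart using chart(2) by blast
    show "\<forall>(U, c)\<in>prod_atlas euclidean_atlas A.
       (\<forall>v w. smooth_on (\<lambda>x. components g (U, c) x v w) (c ` U)) \<and>
       (\<forall>x\<in>c ` U. bilinear (components g (U, c) x) \<and>
          (\<forall>v w. components g (U, c) x v w = components g (U, c) x w v) \<and>
          (\<forall>v. (\<forall>w. components g (U, c) x v w = 0) \<longrightarrow> v = 0))"
      unfolding ball_prod_atlas image_prod_chart
    proof (clarify, intro conjI allI ballI impI)
      fix V d assume Vd: "(V, d) \<in> A"
      interpret local_metric "UNIV \<times> d ` V" "components g (UNIV \<times> V, map_prod id d)"
        by (rule chart(3)[OF Vd])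
      show "smooth_on (\<lambda>z. components g (UNIV \<times> V, map_prod id d) z v w) (UNIV \<times> d ` V)" for v w
        by (rule chart(1)[OF Vd])
      fix z :: "(real ^ 'n) \<times> (real ^ 'm)" assume z: "z \<in> UNIV \<times> d ` V"
      show "bilinear (components g (UNIV \<times> V, map_prod id d) z)" by (rule bil[OF z])
      show "components g (UNIV \<times> V, map_prod id d) z v w
        = components g (UNIV \<times> V, map_prod id d) z w v" for v w
        by (rule sym[OF z])
      show "v = 0" if "\<forall>w. components g (UNIV \<times> V, map_prod id d) z v w = 0" for v
        using nondeg[OF z] that by blast
    qed
  qed
qed

lemma smooth_fun_ridge:
  assumes "smooth_on F UNIV"
  shows "smooth_fun (prod_atlas euclidean_atlas A) ((\<lambda>x. F (\<alpha> \<bullet> x)) \<circ> fst)"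
  unfolding smooth_fun_def ball_prod_atlas image_prod_chart
proof clarify
  fix V d assume Vd: "(V, d) \<in> A"
  note d = smooth_atlasD[OF fibre_atlas Vd]
  have S: "open ((UNIV :: (real ^ 'n) set) \<times> d ` V)" using d(2) by (simp add: open_Times)
  have "smooth_on (\<lambda>z. F (\<alpha> \<bullet> fst z)) ((UNIV :: (real ^ 'n) set) \<times> d ` V)"
    by (rule smooth_on_compose_linear[OF S _ _ assms])
      (auto intro: bounded_linear_compose[OF bounded_linear_inner_right bounded_linear_fst])
  then show "smooth_on ((\<lambda>x. F (\<alpha> \<bullet> x)) \<circ> fst \<circ> inv_into (UNIV \<times> V) (map_prod id d)) (UNIV \<times> d ` V)"
    by (subst smooth_on_cong[OF S]) (auto simp: inv_into_prod_chart[OF d(4)])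
qed

text \<open>The separated equations of all product charts together; the regularity part of the definition of
  a soliton holds for every such warped product.\<close>

lemma GRHS_iff:
  assumes dim: "2 \<le> CARD('n)" and \<alpha>: "\<alpha> \<noteq> 0"
    and H: "smooth_on H UNIV" and U: "smooth_on U UNIV" and \<theta>: "\<theta> \<ge> 0"
  defines "n \<equiv> real CARD('n)" and "m \<equiv> real CARD('m)" and "N \<equiv> sign_change \<epsilon> \<alpha> \<bullet> \<alpha>"
  shows "GRHS (prod_atlas euclidean_atlas A) g ((\<lambda>x. H (\<alpha> \<bullet> x)) \<circ> fst) ((\<lambda>x. U (\<alpha> \<bullet> x)) \<circ> fst) lam \<theta>
    \<longleftrightarrow> (\<forall>(V, d)\<in>A. \<forall>y\<in>d ` V. \<forall>t.
      (n - 2) * (deriv (deriv \<phi>) t / \<phi> t) - m * (deriv (deriv f) t / f t)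
        - 2 * m * (deriv \<phi> t / \<phi> t) * (deriv f t / f t) + deriv (deriv H) t
        + 2 * (deriv \<phi> t / \<phi> t) * deriv H t - \<theta> * (deriv U t)\<^sup>2 = 0 \<and>
      (deriv (deriv \<phi>) t / \<phi> t - (n - 1) * (deriv \<phi> t / \<phi> t)\<^sup>2
        + m * (deriv \<phi> t / \<phi> t) * (deriv f t / f t)
        - (deriv \<phi> t / \<phi> t) * deriv H t) * N = lam / (\<phi> t)\<^sup>2 \<and>
      (\<forall>v w. ricci (components gF (V, d)) y v w =
        ((deriv (deriv f) t / f t - (n - 2) * (deriv \<phi> t / \<phi> t) * (deriv f t / f t)
          + (m - 1) * (deriv f t / f t)\<^sup>2 - (deriv f t / f t) * deriv H t) * N
          + lam / (\<phi> t)\<^sup>2) * ((f t)\<^sup>2 * (\<phi> t)\<^sup>2) * components gF (V, d) y v w) \<and>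
      (deriv (deriv U) t - (n - 2) * (deriv \<phi> t / \<phi> t) * deriv U t
        + m * deriv U t * (deriv f t / f t) - deriv U t * deriv H t) * N = 0)"
  (is "_ \<longleftrightarrow> (\<forall>(V, d)\<in>A. ?P V d)")
proof -
  let ?H = "(\<lambda>x. H (\<alpha> \<bullet> x)) \<circ> fst" and ?U = "(\<lambda>x. U (\<alpha> \<bullet> x)) \<circ> fst"
  have chart: "(\<forall>z\<in>UNIV \<times> d ` V.
       let G = components g (UNIV \<times> V, map_prod id d); h' = ?H \<circ> inv_into (UNIV \<times> V) (map_prod id d);
         u' = ?U \<circ> inv_into (UNIV \<times> V) (map_prod id d) in
         (\<forall>v w. ricci G z v w + hess G h' z v w - \<theta> * (dir_deriv u' v z * dir_deriv u' w z)
                = lam * G z v w) \<and>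
         laplacian G u' z - G z (grad G u' z) (grad G h' z) = 0) \<longleftrightarrow> ?P V d"
    if Vd: "(V, d) \<in> A" for V d
  proof -
    interpret warped_metric "d ` V" "components gF (V, d)" "sign_change \<epsilon>" \<alpha>
      \<phi> "deriv \<phi>" "deriv (deriv \<phi>)" f "deriv f" "deriv (deriv f)"
      "components g (UNIV \<times> V, map_prod id d)"
      by (rule warped_metric_chart[OF Vd])
    have ridge: "\<forall>x. \<forall>y\<in>d ` V.
        ((\<lambda>x. F (\<alpha> \<bullet> x)) \<circ> fst \<circ> inv_into (UNIV \<times> V) (map_prod id d)) (x, y) = F (\<alpha> \<bullet> x)"
      for F :: "real \<Rightarrow> real"
      by (simp add: inv_into_prod_chart[OF smooth_atlasD(4)[OF fibre_atlas Vd]])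
    have dim': "2 \<le> DIM(real ^ 'n)" using dim by simp
    show ?thesis
      unfolding Let_def
        soliton_iff[OF dim' \<alpha> ridge smooth_on_real_deriv(1)[OF H]
          smooth_on_real_deriv(1)[OF smooth_on_real_deriv(2)[OF H]] ridge
          smooth_on_real_deriv(1)[OF U] smooth_on_real_deriv(1)[OF smooth_on_real_deriv(2)[OF U]]]
      by (simp add: n_def m_def N_def)
  qed
  have "GRHS (prod_atlas euclidean_atlas A) g ?H ?U lam \<theta> \<longleftrightarrow>
    (\<forall>(V, d)\<in>A. \<forall>z\<in>UNIV \<times> d ` V.
       let G = components g (UNIV \<times> V, map_prod id d); h' = ?H \<circ> inv_into (UNIV \<times> V) (map_prod id d);
         u' = ?U \<circ> inv_into (UNIV \<times> V) (map_prod id d) in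
         (\<forall>v w. ricci G z v w + hess G h' z v w - \<theta> * (dir_deriv u' v z * dir_deriv u' w z)
                = lam * G z v w) \<and>
         laplacian G u' z - G z (grad G u' z) (grad G h' z) = 0)"
    unfolding GRHS_def ball_prod_atlas image_prod_chart
    using semi_riemannian_g smooth_fun_ridge[OF H] smooth_fun_ridge[OF U] \<theta> by blast
  also have "\<dots> \<longleftrightarrow> (\<forall>(V, d)\<in>A. ?P V d)"
  proof (rule ball_cong[OF refl])
    fix z assume "z \<in> A"
    then show "(case z of (V, d) \<Rightarrow> \<forall>z\<in>UNIV \<times> d ` V.
       let G = components g (UNIV \<times> V, map_prod id d); h' = ?H \<circ> inv_into (UNIV \<times> V) (map_prod id d);
         u' = ?U \<circ> inv_into (UNIV \<times> V) (map_prod id d) in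
         (\<forall>v w. ricci G z v w + hess G h' z v w - \<theta> * (dir_deriv u' v z * dir_deriv u' w z)
                = lam * G z v w) \<and>
         laplacian G u' z - G z (grad G u' z) (grad G h' z) = 0) = (case z of (V, d) \<Rightarrow> ?P V d)"
      by (cases z) (simp only: split_conv chart)
  qed
  finally show ?thesis .
qed

end

theorem theorem1p6:
  fixes \<alpha> :: "real ^ 'n" and \<epsilon> :: "'n \<Rightarrow> real"
    and \<xi> :: "real ^ 'n \<Rightarrow> real"
    and \<phi> f h u :: "real \<Rightarrow> real"
    and AF :: "('f::{t2_space,second_countable_topology}, real ^ 'm) chart set"
    and gF :: "'f metric"
    and lam \<theta> n m norm\<alpha> :: real
  assumes dim_base: "CARD('n) \<ge> 2"
    and n: "n = real CARD('n)" and m: "m = real CARD('m)"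
    and eps: "\<And>i. \<epsilon> i = 1 \<or> \<epsilon> i = - 1"
    and norm\<alpha>: "norm\<alpha> = (\<Sum>i\<in>UNIV. \<epsilon> i * (\<alpha> $ i)\<^sup>2)"
    and alpha: "\<alpha> \<noteq> 0"
    and xi: "\<xi> = (\<lambda>x. \<Sum>i\<in>UNIV. \<alpha> $ i * x $ i)"
    and smooth: "smooth_on (\<phi> \<circ> \<xi>) UNIV" "smooth_on (f \<circ> \<xi>) UNIV"
      "smooth_on (h \<circ> \<xi>) UNIV" "smooth_on (u \<circ> \<xi>) UNIV"
    and phi_pos: "\<And>x. (\<phi> \<circ> \<xi>) x > 0"
    and f_pos: "\<And>x. (f \<circ> \<xi>) x > 0"
    and u_nonconst: "\<not> (u \<circ> \<xi>) constant_on UNIV"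
    and fiber: "semi_riemannian AF gF"
    and theta: "\<theta> \<ge> 0"
  shows "GRHS (prod_atlas euclidean_atlas AF)
           (warped_product
              (scale_metric (\<lambda>x. 1 / ((\<phi> \<circ> \<xi>) x)\<^sup>2) (semi_euclidean \<epsilon>)) (f \<circ> \<xi>) gF)
           (h \<circ> \<xi> \<circ> fst) (u \<circ> \<xi> \<circ> fst) lam \<theta>
    \<longleftrightarrow> (\<exists>\<mu>. ricci_eq_metric AF gF \<mu> \<and>
      (\<forall>t.
        (n - 2) * (deriv (deriv \<phi>) t / \<phi> t) - m * (deriv (deriv f) t / f t)
          - 2 * m * (deriv \<phi> t / \<phi> t) * (deriv f t / f t) + deriv (deriv h) t
          + 2 * (deriv \<phi> t / \<phi> t) * deriv h t - \<theta> * (deriv u t)\<^sup>2 = 0 \<and>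
        (deriv (deriv \<phi>) t / \<phi> t - (n - 1) * (deriv \<phi> t / \<phi> t)\<^sup>2
          + m * (deriv \<phi> t / \<phi> t) * (deriv f t / f t)
          - (deriv \<phi> t / \<phi> t) * deriv h t) * norm\<alpha> = lam / (\<phi> t)\<^sup>2 \<and>
        (deriv (deriv f) t / f t - (n - 2) * (deriv \<phi> t / \<phi> t) * (deriv f t / f t)
          + (m - 1) * (deriv f t / f t)\<^sup>2 - (deriv f t / f t) * deriv h t) * norm\<alpha>
          = \<mu> / ((f t)\<^sup>2 * (\<phi> t)\<^sup>2) - lam / (\<phi> t)\<^sup>2 \<and>
        (deriv (deriv u) t - (n - 2) * (deriv \<phi> t / \<phi> t) * deriv u t
          + m * deriv u t * (deriv f t / f t) - deriv u t * deriv h t) * norm\<alpha> = 0))"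
proof -
  have \<xi>: "\<xi> = (\<lambda>x. \<alpha> \<bullet> x)" by (simp add: xi inner_vec_def)
  have N: "norm\<alpha> = sign_change \<epsilon> \<alpha> \<bullet> \<alpha>"
    by (simp add: norm\<alpha> sign_change_inner power2_eq_square mult.assoc)
  have smooth1: "smooth_on \<phi> UNIV" "smooth_on f UNIV" "smooth_on h UNIV" "smooth_on u UNIV"
    using smooth smooth_on_ridgeD[OF alpha] unfolding \<xi> comp_def by auto
  have "\<alpha> \<bullet> (t / (\<alpha> \<bullet> \<alpha>)) *\<^sub>R \<alpha> = t" for t using alpha by simp
  then have pos: "\<phi> t > 0" "f t > 0" for t
    using phi_pos f_pos unfolding \<xi> comp_def by metis+
  interpret ridge_warped_product \<epsilon> \<alpha> \<phi> f AF gF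
    using eps smooth1 pos fiber by unfold_locales
  \<comment> \<open>The value of \<open>\<mu>\<close> required by the third equation at \<open>t\<close>.\<close>
  define M where "M t = ((deriv (deriv f) t / f t - (n - 2) * (deriv \<phi> t / \<phi> t) * (deriv f t / f t)
    + (m - 1) * (deriv f t / f t)\<^sup>2 - (deriv f t / f t) * deriv h t) * norm\<alpha> + lam / (\<phi> t)\<^sup>2)
    * ((f t)\<^sup>2 * (\<phi> t)\<^sup>2)" for t
  define P where "P t \<longleftrightarrow> (n - 2) * (deriv (deriv \<phi>) t / \<phi> t) - m * (deriv (deriv f) t / f t)
          - 2 * m * (deriv \<phi> t / \<phi> t) * (deriv f t / f t) + deriv (deriv h) t
          + 2 * (deriv \<phi> t / \<phi> t) * deriv h t - \<theta> * (deriv u t)\<^sup>2 = 0" for t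
  define Q where "Q t \<longleftrightarrow> (deriv (deriv \<phi>) t / \<phi> t - (n - 1) * (deriv \<phi> t / \<phi> t)\<^sup>2
          + m * (deriv \<phi> t / \<phi> t) * (deriv f t / f t)
          - (deriv \<phi> t / \<phi> t) * deriv h t) * norm\<alpha> = lam / (\<phi> t)\<^sup>2" for t
  define R where "R t \<longleftrightarrow> (deriv (deriv u) t - (n - 2) * (deriv \<phi> t / \<phi> t) * deriv u t
          + m * deriv u t * (deriv f t / f t) - deriv u t * deriv h t) * norm\<alpha> = 0" for t
  have third: "(deriv (deriv f) t / f t - (n - 2) * (deriv \<phi> t / \<phi> t) * (deriv f t / f t)
          + (m - 1) * (deriv f t / f t)\<^sup>2 - (deriv f t / f t) * deriv h t) * norm\<alpha>
          = \<mu> / ((f t)\<^sup>2 * (\<phi> t)\<^sup>2) - lam / (\<phi> t)\<^sup>2 \<longleftrightarrow> M t = \<mu>" for t \<mu>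
  proof -
    have "(f t)\<^sup>2 * (\<phi> t)\<^sup>2 \<noteq> 0" using pos[of t] by simp
    then show ?thesis unfolding M_def eq_diff_eq eq_divide_eq by simp
  qed
  have "GRHS (prod_atlas euclidean_atlas AF)
           (warped_product
              (scale_metric (\<lambda>x. 1 / ((\<phi> \<circ> \<xi>) x)\<^sup>2) (semi_euclidean \<epsilon>)) (f \<circ> \<xi>) gF)
           (h \<circ> \<xi> \<circ> fst) (u \<circ> \<xi> \<circ> fst) lam \<theta>
    \<longleftrightarrow> (\<forall>(V, d)\<in>AF. \<forall>y\<in>d ` V. \<forall>t. P t \<and> Q t \<and>
      (\<forall>v w. ricci (components gF (V, d)) y v w = M t * components gF (V, d) y v w) \<and> R t)"
    using GRHS_iff[OF dim_base alpha smooth1(3,4) theta, of lam]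
    unfolding g_def P_def Q_def R_def M_def N n m \<xi> by (simp add: comp_def)
  also have "\<dots> \<longleftrightarrow> (\<exists>\<mu>. ricci_eq_metric AF gF \<mu> \<and> (\<forall>t. P t \<and> Q t \<and> M t = \<mu> \<and> R t))"
  proof
    assume L: "\<forall>(V, d)\<in>AF. \<forall>y\<in>d ` V. \<forall>t. P t \<and> Q t \<and>
      (\<forall>v w. ricci (components gF (V, d)) y v w = M t * components gF (V, d) y v w) \<and> R t"
    obtain V d p where Vd: "(V, d) \<in> AF" "p \<in> V"
      using smooth_atlas_nonempty[OF fibre_atlas] by blast
    interpret V: local_metric "d ` V" "components gF (V, d)"
      by (rule semi_riemannian_local_metric[OF fibre Vd(1)])
    have y: "d p \<in> d ` V" using Vd(2) by simp
    have PQR: "P t" "Q t" "R t"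
      and ric: "ricci (components gF (V, d)) (d p) v w = M t * components gF (V, d) (d p) v w" for t v w
      using bspec[OF L Vd(1)] y by auto
    \<comment> \<open>\<open>k \<noteq> 0\<close> at one point of the fibre, so \<open>M t k = Ric\<^sub>k = M 0 k\<close> there determines \<open>M t\<close>.\<close>
    obtain v w where vw: "components gF (V, d) (d p) v w \<noteq> 0"
      using V.nondeg[OF y, of "axis undefined 1"] by (metis axis_eq_0_iff zero_neq_one)
    have "M t = M 0" for t using ric[of v w t] ric[of v w 0] vw by simp
    moreover have "ricci_eq_metric AF gF (M 0)"
      unfolding ricci_eq_metric_def using L by blast
    ultimately show "\<exists>\<mu>. ricci_eq_metric AF gF \<mu> \<and> (\<forall>t. P t \<and> Q t \<and> M t = \<mu> \<and> R t)"
      using PQR by blast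
  next
    assume "\<exists>\<mu>. ricci_eq_metric AF gF \<mu> \<and> (\<forall>t. P t \<and> Q t \<and> M t = \<mu> \<and> R t)"
    then obtain \<mu> where "ricci_eq_metric AF gF \<mu>" "\<forall>t. P t \<and> Q t \<and> M t = \<mu> \<and> R t" by blast
    then show "\<forall>(V, d)\<in>AF. \<forall>y\<in>d ` V. \<forall>t. P t \<and> Q t \<and>
      (\<forall>v w. ricci (components gF (V, d)) y v w = M t * components gF (V, d) y v w) \<and> R t"
      unfolding ricci_eq_metric_def by fast
  qed
  finally show ?thesis unfolding third P_def[symmetric] Q_def[symmetric] R_def[symmetric] .
qed

end
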